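(* Let $\mathcal{X}$ be a geodesic metric space. (1) If $\mathcal{X}$ is CAT($k$), then $D_{\rm convex}\ge \pi/(2\sqrt{\max(k,0)})$. (2) If $\mathcal{X}$ is CAT($k$), then $D_{\rm geodesic}\ge \pi/\sqrt{\max(k,0)}$. (3) If $\mathcal{X}$ is a surface with a constant curvature $k>0$, then $D_{L_1}\ge \pi/(2\sqrt{k})$. Here the right-hand sides in (1) and (2) are read as $\infty$ when $k\le 0$.
   Context: $\mathcal{X}$ is a geodesic metric space with metric $d$, i.e. $d(x,x')$ is the length of a shortest path (geodesic) between $x$ and $x'$. The diameter of a subset $A\subset\mathcal{X}$ is the length of the longest geodesic in $A$. CAT($k$), for $k\in\mathbb{R}$: consider any geodesic triangle with vertices $a,b,c\in\mathcal{X}$ whose perimeter is less than $2\pi/\sqrt{\max(k,0)}$, and a comparison triangle $a',b',c'$ with the same side lengths on a surface $M_k$ of constant curvature $k$ (the Euclidean plane for $k=0$). For any point $x$ on the geodesic edge between $b$ and $c$, let $x'$ be the point on the edge $b'c'$ with $d(b,x)=d_{M_k}(b',x')$. The space is CAT($k$) if $d(x,a)\le d_{M_k}(x',a')$ for all such $a,b,c$ and $x$, where $d_{M_k}$ is geodesic length on $M_k$. Classes of subsets $A\subset\mathcal{X}$: $\mathcal{C}_{\rm convex}$: those $A$ such that for each $p\in A$ the function $f_p(x)=d(p,x)$ is strictly convex on $A$, where convex means geodesically convex (a function $f$ is convex iff $f(\gamma(t))$ is convex in $t$ for every geodesic $\gamma(t)$). $\mathcal{C}_{L_1}$: those $A$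 such that for any probability measure whose support is in $A$ and non-empty (with $X$ a random variable having this distribution), the intrinsic $L_1$-mean $\arg\min_{m\in\mathcal{X}}E[d(X,m)]$ exists uniquely. $\mathcal{C}_{\rm geodesic}$: those $A$ such that for every pair $p,q\in A$ the geodesic between $p$ and $q$ is unique. $D_{\rm convex}$, $D_{L_1}$ and $D_{\rm geodesic}$ are the largest values (including $\infty$) such that every subset of $\mathcal{X}$ whose diameter is less than the value belongs to $\mathcal{C}_{\rm convex}$, $\mathcal{C}_{L_1}$ and $\mathcal{C}_{\rm geodesic}$, respectively.
   Formalization: (1), (3) fail as stated: f_p is affine along geodesics from p; two-point measures have many means. Strictness is asked unless |d(p,x)-d(p,y)|=d(x,y); L1-means are unique unless half the mass is behind each end of a segment. In (3) the surface is the sphere, not the projective plane. *)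

theory Defs
  imports "HOL-Analysis.Analysis" "HOL-Probability.Probability"
begin

text \<open>
  Metric spaces are explicit pairs of a carrier \<open>M\<close> and a distance \<open>d\<close>
  (locale \<open>Metric_space\<close>), so that the surfaces of constant curvature \<open>k\<close> below
  are instances for every \<open>k\<close>.
\<close>

section \<open>Geodesics\<close>

text \<open>Shortest paths, parametrised on [0,1] proportionally to arc length.\<close>

definition geodesic_path :: "'a set \<Rightarrow> ('a \<Rightarrow> 'a \<Rightarrow> real) \<Rightarrow> (real \<Rightarrow> 'a) \<Rightarrow> 'a \<Rightarrow> 'a \<Rightarrow> bool" where
  "geodesic_path M d \<gamma> x y \<longleftrightarrow>
     \<gamma> ` {0..1} \<subseteq> M \<and> \<gamma> 0 = x \<and> \<gamma> 1 = y \<and>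
     (\<forall>s\<in>{0..1}. \<forall>t\<in>{0..1}. d (\<gamma> s) (\<gamma> t) = \<bar>s - t\<bar> * d x y)"

definition geodesic_segment :: "'a set \<Rightarrow> ('a \<Rightarrow> 'a \<Rightarrow> real) \<Rightarrow> 'a set \<Rightarrow> 'a \<Rightarrow> 'a \<Rightarrow> bool" where
  "geodesic_segment M d S x y \<longleftrightarrow> (\<exists>\<gamma>. geodesic_path M d \<gamma> x y \<and> S = \<gamma> ` {0..1})"

definition geodesic_space :: "'a set \<Rightarrow> ('a \<Rightarrow> 'a \<Rightarrow> real) \<Rightarrow> bool" where
  "geodesic_space M d \<longleftrightarrow>
     Metric_space M d \<and> (\<forall>x\<in>M. \<forall>y\<in>M. \<exists>\<gamma>. geodesic_path M d \<gamma> x y)"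

section \<open>The surfaces of constant curvature\<close>

text \<open>
  The sphere of radius \<open>1 / sqrt k\<close>, the Euclidean plane, and the upper sheet of a
  hyperboloid in Minkowski space, each with its geodesic distance.
\<close>

definition lorentz :: "real^3 \<Rightarrow> real^3 \<Rightarrow> real" where
  "lorentz x y = x$1 * y$1 + x$2 * y$2 - x$3 * y$3"

definition model_surface :: "real \<Rightarrow> (real^3) set" where
  "model_surface k =
     (if k > 0 then sphere 0 (1 / sqrt k)
      else if k = 0 then {x. x$3 = 0}
      else {x. lorentz x x = 1 / k \<and> x$3 > 0})"

definition model_dist :: "real \<Rightarrow> real^3 \<Rightarrow> real^3 \<Rightarrow> real" where
  "model_dist k x y =
     (if k > 0 then arccos (k * (x \<bullet> y)) / sqrt k
      else if k = 0 then dist x y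
      else arcosh (k * lorentz x y) / sqrt (- k))"

text \<open>
  A (complete) surface of constant curvature \<open>k\<close> means a copy of the model surface.
  (The projective plane of curvature \<open>k > 0\<close> is not included: three equidistant points on a
  closed geodesic of it have pairwise distance \<open>pi / (3 * sqrt k)\<close> but no unique L1-mean.)
\<close>

definition constant_curvature_surface :: "'a set \<Rightarrow> ('a \<Rightarrow> 'a \<Rightarrow> real) \<Rightarrow> real \<Rightarrow> bool" where
  "constant_curvature_surface M d k \<longleftrightarrow>
     (\<exists>f. bij_betw f M (model_surface k) \<and>
          (\<forall>x\<in>M. \<forall>y\<in>M. model_dist k (f x) (f y) = d x y))"

section \<open>CAT(k) spaces\<close>

text \<open>
  In \<open>ereal\<close>, a positive number divided by 0 is \<open>\<infinity>\<close>; hence the perimeter is unrestricted when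
  \<open>k \<le> 0\<close>.  Only the edge \<open>S\<close> between \<open>b\<close> and \<open>c\<close> has to be named, since the other two edges
  enter through their lengths alone.  Below the perimeter bound a comparison triangle exists,
  is unique up to isometry and has unique edges, so it does not matter that these are
  quantified existentially.
\<close>

definition CAT :: "'a set \<Rightarrow> ('a \<Rightarrow> 'a \<Rightarrow> real) \<Rightarrow> real \<Rightarrow> bool" where
  "CAT M d k \<longleftrightarrow> geodesic_space M d \<and>
     (\<forall>a\<in>M. \<forall>b\<in>M. \<forall>c\<in>M. \<forall>S.
        geodesic_segment M d S b c \<longrightarrow>
        ereal (d a b + d b c + d c a) < ereal (2 * pi) / ereal (sqrt (max k 0)) \<longrightarrow>
        (\<exists>a'\<in>model_surface k. \<exists>b'\<in>model_surface k. \<exists>c'\<in>model_surface k. \<exists>S'.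
           model_dist k a' b' = d a b \<and> model_dist k b' c' = d b c \<and> model_dist k c' a' = d c a \<and>
           geodesic_segment (model_surface k) (model_dist k) S' b' c' \<and>
           (\<forall>x\<in>S. \<forall>x'\<in>S'. d b x = model_dist k b' x' \<longrightarrow> d x a \<le> model_dist k x' a')))"

section \<open>Distance functions that are strictly convex\<close>

text \<open>
  If \<open>x\<close>, \<open>y\<close>, \<open>p\<close> are aligned with \<open>p\<close> at an end, then the triangle inequality forces
  \<open>d p\<close> to be affine (with slope \<open>\<plusminus>1\<close> in arc length) on every geodesic from \<open>x\<close> to \<open>y\<close>.
\<close>

definition radial :: "('a \<Rightarrow> 'a \<Rightarrow> real) \<Rightarrow> 'a \<Rightarrow> 'a \<Rightarrow> 'a \<Rightarrow> bool" where
  "radial d p x y \<longleftrightarrow> \<bar>d p x - d p y\<bar> = d x y"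

text \<open>
  Strict convexity of the distance functions \<open>d p\<close> on \<open>A\<close>.  With no exception at all it would
  fail for every \<open>A\<close> that contains a nontrivial geodesic (take \<open>p\<close> to be an end of it), so
  that the critical diameter would be 0 in every geodesic space with more than one point.
  Hence strictness is required of all geodesics in \<open>A\<close> but the radial ones; ordinary convexity
  is required of all.  As subsegments are geodesics too, comparing with the chord between the
  two ends is enough.
\<close>

definition C_convex :: "'a set \<Rightarrow> ('a \<Rightarrow> 'a \<Rightarrow> real) \<Rightarrow> 'a set set" where
  "C_convex M d =
     {A. A \<subseteq> M \<and>
         (\<forall>p\<in>A. \<forall>x y \<gamma>. geodesic_path M d \<gamma> x y \<longrightarrow> \<gamma> ` {0..1} \<subseteq> A \<longrightarrow>
            convex_on {0..1} (\<lambda>t. d p (\<gamma> t)) \<and>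
            (\<not> radial d p x y \<longrightarrow>
               (\<forall>t\<in>{0<..<1}. d p (\<gamma> t) < (1 - t) * d p x + t * d p y)))}"

section \<open>Intrinsic L1-means\<close>

definition borel_prob :: "'a set \<Rightarrow> ('a \<Rightarrow> 'a \<Rightarrow> real) \<Rightarrow> 'a measure \<Rightarrow> bool" where
  "borel_prob M d P \<longleftrightarrow> prob_space P \<and> space P = M \<and>
     sets P = sigma_sets M {U. openin (Metric_space.mtopology M d) U}"

definition supp :: "'a set \<Rightarrow> ('a \<Rightarrow> 'a \<Rightarrow> real) \<Rightarrow> 'a measure \<Rightarrow> 'a set" where
  "supp M d P = {x\<in>M. \<forall>U. openin (Metric_space.mtopology M d) U \<and> x \<in> U \<longrightarrow> measure P U > 0}"

definition is_L1_mean :: "'a set \<Rightarrow> ('a \<Rightarrow> 'a \<Rightarrow> real) \<Rightarrow> 'a measure \<Rightarrow> 'a \<Rightarrow> bool" where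
  "is_L1_mean M d P m \<longleftrightarrow> m \<in> M \<and>
     (\<forall>m'\<in>M. (\<integral>\<^sup>+x. ennreal (d x m) \<partial>P) \<le> (\<integral>\<^sup>+x. ennreal (d x m') \<partial>P))"

text \<open>
  Half of the mass lies behind the end \<open>a\<close> of a segment and half behind the other end \<open>b\<close>, as
  for \<open>(\<delta>\<^sub>a + \<delta>\<^sub>b) / 2\<close>.  The expected distance is then constant on each geodesic
  from \<open>a\<close> to \<open>b\<close>, just as the median of an even sample on a line is not unique.
\<close>

definition evenly_split :: "'a set \<Rightarrow> ('a \<Rightarrow> 'a \<Rightarrow> real) \<Rightarrow> 'a measure \<Rightarrow> bool" where
  "evenly_split M d P \<longleftrightarrow>
     (\<exists>a\<in>M. \<exists>b\<in>M. a \<noteq> b \<and>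
        measure P {x\<in>M. d x b = d x a + d a b} = 1 / 2 \<and>
        measure P {x\<in>M. d x a = d x b + d b a} = 1 / 2)"

text \<open>
  Existence is required of all measures, uniqueness of those that are not evenly split.
  With no exception, two-point measures would rule out every \<open>A\<close> with more than one
  point, so that the critical diameter would again be 0.  The support has to be assumed
  nonempty because it can be empty in nonseparable spaces.
\<close>

definition C_L1 :: "'a set \<Rightarrow> ('a \<Rightarrow> 'a \<Rightarrow> real) \<Rightarrow> 'a set set" where
  "C_L1 M d =
     {A. A \<subseteq> M \<and>
         (\<forall>P. borel_prob M d P \<longrightarrow> supp M d P \<subseteq> A \<longrightarrow> supp M d P \<noteq> {} \<longrightarrow>
            (\<exists>m. is_L1_mean M d P m) \<and>
            (\<not> evenly_split M d P \<longrightarrow> (\<exists>!m. is_L1_mean M d P m)))}"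

section \<open>Unique geodesics\<close>

definition C_geodesic :: "'a set \<Rightarrow> ('a \<Rightarrow> 'a \<Rightarrow> real) \<Rightarrow> 'a set set" where
  "C_geodesic M d = {A. A \<subseteq> M \<and> (\<forall>p\<in>A. \<forall>q\<in>A. \<exists>!S. geodesic_segment M d S p q)}"

section \<open>Critical diameters\<close>

text \<open>
  The length of the longest geodesic between points of \<open>A\<close>, as a supremum.
  The geodesics themselves may leave \<open>A\<close>; otherwise two antipodal points
  of a sphere would form a set of diameter 0.
\<close>

definition diam :: "('a \<Rightarrow> 'a \<Rightarrow> real) \<Rightarrow> 'a set \<Rightarrow> ereal" where
  "diam d A = (SUP p\<in>A. SUP q\<in>A. ereal (d p q))"

definition critical_diam :: "'a set \<Rightarrow> ('a \<Rightarrow> 'a \<Rightarrow> real) \<Rightarrow> 'a set set \<Rightarrow> ereal" where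
  "critical_diam M d C = Sup {r. \<forall>A. A \<subseteq> M \<and> diam d A < r \<longrightarrow> A \<in> C}"

text \<open>The supremum is attained, so it is the largest value with the property.\<close>

lemma critical_diam_attained:
  assumes "A \<subseteq> M" "diam d A < critical_diam M d C"
  shows "A \<in> C"
  using assms unfolding critical_diam_def less_Sup_iff by blast

definition D_convex :: "'a set \<Rightarrow> ('a \<Rightarrow> 'a \<Rightarrow> real) \<Rightarrow> ereal" where
  "D_convex M d = critical_diam M d (C_convex M d)"

definition D_L1 :: "'a set \<Rightarrow> ('a \<Rightarrow> 'a \<Rightarrow> real) \<Rightarrow> ereal" where
  "D_L1 M d = critical_diam M d (C_L1 M d)"

definition D_geodesic :: "'a set \<Rightarrow> ('a \<Rightarrow> 'a \<Rightarrow> real) \<Rightarrow> ereal" where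
  "D_geodesic M d = critical_diam M d (C_geodesic M d)"

end

theory Submission
  imports Defs
begin

text \<open>
  Comparison with the model surface is needed at midpoints of geodesics only: a closed subset of an
  interval that contains the ends and is closed under midpoints is the whole interval.  Let \<open>x\<close> be the
  midpoint of \<open>b\<close> and \<open>c\<close> in the unit sphere and let \<open>\<beta>\<close>, \<open>\<gamma>\<close>, \<open>D\<close> be the distances \<open>ab\<close>, \<open>ac\<close>, \<open>bc\<close>.  Then
  \<open>cos (xa) cos (D/2) = cos ((\<beta> + \<gamma>)/2) cos ((\<beta> - \<gamma>)/2)\<close>, and \<open>\<bar>\<beta> - \<gamma>\<bar> \<le> D\<close> gives
  \<open>xa \<le> (\<beta> + \<gamma>)/2\<close>, with equality only in the radial case; taking \<open>a\<close> to be another midpoint gives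
  \<open>xa = 0\<close>.  The hyperbolic plane has the same formula with \<open>cosh\<close>, the Euclidean plane has the
  length of the median.

  On the sphere, L1-means exist by compactness.  If a point \<open>z\<close> of the support were at distance at
  least \<open>\<pi>/2\<close> from a mean \<open>m\<close>, then moving \<open>m\<close> slightly beyond its mirror image in the plane orthogonal
  to \<open>z\<close> would bring it closer to every point of the support, as these are all at distance less than
  \<open>\<pi>/2\<close> from \<open>z\<close>.  Hence the midpoint inequality applies to two means \<open>m\<^sub>1\<close> and \<open>m\<^sub>2\<close>.  By minimality it
  is an equality almost everywhere, so almost all points lie behind \<open>m\<^sub>1\<close> or behind \<open>m\<^sub>2\<close>, and
  the two expected distances agree only if both sides have the same mass.
\<close>

section \<open>Closed sets and continuous functions tested at midpoints\<close>

text \<open>A missing point \<open>t\<close> lies in a gap of \<open>T\<close>. By compactness the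
  gap has ends \<open>u\<close> and \<open>v\<close> in \<open>T\<close>, and their midpoint would
  lie in \<open>T\<close> inside the gap.\<close>

lemma midpoint_closed_real_interval:
  fixes T :: "real set"
  assumes "closed T" "a \<in> T" "b \<in> T"
    and mid: "\<And>u v. u \<in> T \<Longrightarrow> v \<in> T \<Longrightarrow> a \<le> u \<Longrightarrow> u < v \<Longrightarrow> v \<le> b \<Longrightarrow> (u + v) / 2 \<in> T"
  shows "{a..b} \<subseteq> T"
proof (rule ccontr)
  assume "\<not> {a..b} \<subseteq> T"
  then obtain t where "t \<in> {a..b}" and tT: "t \<notin> T" by blast
  then have t: "a \<le> t" "t \<le> b" "t \<notin> T" by auto
  have L: "T \<inter> {a..t} \<noteq> {}" "compact (T \<inter> {a..t})" 
    using assms t by (auto intro: closed_Int_compact)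
  obtain u where u: "u \<in> T \<inter> {a..t}" "\<And>s. s \<in> T \<inter> {a..t} \<Longrightarrow> s \<le> u"
    using compact_attains_sup[OF L(2,1)] by blast
  have R: "T \<inter> {t..b} \<noteq> {}" "compact (T \<inter> {t..b})" 
    using assms t by (auto intro: closed_Int_compact)
  obtain v where v: "v \<in> T \<inter> {t..b}" "\<And>s. s \<in> T \<inter> {t..b} \<Longrightarrow> v \<le> s"
    using compact_attains_inf[OF R(2,1)] by blast
  have uv: "u < t" "t < v" using u v t by (auto simp: order_less_le)
  have "(u + v) / 2 \<in> T" using mid u v uv by auto
  then show False
    using u(1) v(1) u(2)[of "(u + v) / 2"] v(2)[of "(u + v) / 2"] uv by (cases "(u + v) / 2 \<le> t") auto
qed

text \<open>Along a fixed chord, the parameters at which the chord inequality holds form a set that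
  is closed by continuity and stable under midpoints by \<open>mid\<close>.\<close>

lemma midpoint_convex_on:
  fixes f :: "real \<Rightarrow> real"
  assumes cont: "continuous_on {a..b} f"
    and mid: "\<And>u v. u \<in> {a..b} \<Longrightarrow> v \<in> {a..b} \<Longrightarrow> f ((u + v) / 2) \<le> (f u + f v) / 2"
  shows "convex_on {a..b} f"
proof (rule convex_onI)
  fix t x y :: real
  assume t: "0 < t" "t < 1" and x: "x \<in> {a..b}" and y: "y \<in> {a..b}"
  define p where "p s = (1 - s) * x + s * y" for s
  define T where "T = {s \<in> {0..1}. f (p s) - ((1 - s) * f x + s * f y) \<le> 0}"
  have p: "p s \<in> {a..b}" if "s \<in> {0..1}" for s
    using convexD_alt[of "{a..b}" x y s] x y that by (auto simp: p_def)
  have "continuous_on {0..1} (\<lambda>s. f (p s) - ((1 - s) * f x + s * f y))"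
    by (intro continuous_intros continuous_on_compose2[OF cont])
       (use p in \<open>auto simp: p_def intro!: continuous_intros\<close>)
  then have "closed T"
    unfolding T_def by (intro continuous_on_closed_Collect_le) auto
  moreover have "0 \<in> T" "1 \<in> T" by (auto simp: T_def p_def)
  moreover have "(u + v) / 2 \<in> T" if "u \<in> T" "v \<in> T" for u v
  proof -
    have pm: "p ((u + v) / 2) = (p u + p v) / 2" by (simp add: p_def field_simps)
    have "f (p ((u + v) / 2)) \<le> (f (p u) + f (p v)) / 2"
      unfolding pm using that by (intro mid p) (auto simp: T_def)
    moreover have "(1 - (u + v) / 2) * f x + (u + v) / 2 * f y
        = (((1 - u) * f x + u * f y) + ((1 - v) * f x + v * f y)) / 2" by (simp add: field_simps)
    ultimately show ?thesis using that by (auto simp: T_def)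
  qed
  ultimately have "{0..1} \<subseteq> T" by (rule midpoint_closed_real_interval)
  with t have "t \<in> T" by auto
  then show "f ((1 - t) *\<^sub>R x + t *\<^sub>R y) \<le> (1 - t) * f x + t * f y" by (simp add: T_def p_def)
qed simp

section \<open>Midpoints in the model surfaces\<close>

lemma abs_inner_le_1:
  fixes u v :: "'a::real_inner"
  shows "norm u = 1 \<Longrightarrow> norm v = 1 \<Longrightarrow> \<bar>u \<bullet> v\<bar> \<le> 1"
  using Cauchy_Schwarz_ineq2[of u v] by simp

lemma arccos_inner_bounds:
  fixes u v :: "'a::real_inner"
  assumes "norm u = 1" "norm v = 1"
  shows "0 \<le> arccos (u \<bullet> v)" "arccos (u \<bullet> v) \<le> pi" "cos (arccos (u \<bullet> v)) = u \<bullet> v"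
  using abs_inner_le_1[OF assms] by (auto simp: arccos_lbound arccos_ubound cos_arccos_abs abs_le_iff)

text \<open>The vector \<open>b + c\<close> is \<open>2 * cos (D/2)\<close> times \<open>x\<close>,
  where \<open>D\<close> is the angle between \<open>b\<close> and \<open>c\<close>. Pairing this
  with \<open>a\<close> and turning the sum of cosines into a product gives the formula.\<close>

lemma spherical_midpoint:
  fixes a b c x :: "'a::real_inner"
  assumes n: "norm a = 1" "norm b = 1" "norm c = 1" "norm x = 1"
    and xb: "arccos (x \<bullet> b) = arccos (b \<bullet> c) / 2" and xc: "arccos (x \<bullet> c) = arccos (b \<bullet> c) / 2"
  shows "cos (arccos (x \<bullet> a)) * cos (arccos (b \<bullet> c) / 2)
    = cos ((arccos (a \<bullet> b) + arccos (a \<bullet> c)) / 2) * cos ((arccos (a \<bullet> b) - arccos (a \<bullet> c)) / 2)"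
proof -
  define h where "h = cos (arccos (b \<bullet> c) / 2)"
  note cc = arccos_inner_bounds(3)
  have h: "x \<bullet> b = h" "x \<bullet> c = h" 
    using cc[OF n(4,2)] cc[OF n(4,3)] xb xc unfolding h_def by simp_all
  have "b \<bullet> c = 2 * h\<^sup>2 - 1" 
    using cc[OF n(2,3)] cos_double_cos[of "arccos (b \<bullet> c) / 2"] by (simp add: h_def)
  moreover have "u \<bullet> u = 1" if "norm u = 1" for u :: 'a using that by (simp add: dot_square_norm)
  \<comment> \<open>The square expands to
    \<open>2 + 2 * (2 * h\<^sup>2 - 1) - 8 * h\<^sup>2 + 4 * h\<^sup>2\<close>, which is 0.\<close>
  ultimately have "(b + c - (2 * h) *\<^sub>R x) \<bullet> (b + c - (2 * h) *\<^sub>R x) = 0"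
    using h n by (simp add: inner_diff inner_add inner_commute algebra_simps power2_eq_square)
  then have "b + c = (2 * h) *\<^sub>R x" by simp
  then have "a \<bullet> b + a \<bullet> c = 2 * h * (x \<bullet> a)" 
    using inner_add_right[of a b c] by (simp add: inner_commute)
  moreover have "a \<bullet> b + a \<bullet> c = 2 * cos ((arccos (a \<bullet> b) + arccos (a \<bullet> c)) / 2) * cos ((arccos (a \<bullet> b) - arccos (a \<bullet> c)) / 2)"
    using cos_plus_cos[of "arccos (a \<bullet> b)" "arccos (a \<bullet> c)"] cc[OF n(1,2)] cc[OF n(1,3)] by simp
  ultimately show ?thesis using cc[OF n(4,1)] by (simp add: h_def)
qed

lemma lorentz_simps:
  "lorentz (x + y) z = lorentz x z + lorentz y z" "lorentz z (x + y) = lorentz z x + lorentz z y"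
  "lorentz (x - y) z = lorentz x z - lorentz y z" "lorentz z (x - y) = lorentz z x - lorentz z y"
  "lorentz (r *\<^sub>R x) z = r * lorentz x z" "lorentz z (r *\<^sub>R x) = r * lorentz z x"
  by (simp_all add: lorentz_def algebra_simps)

lemma lorentz_commute: "lorentz x y = lorentz y x"
  by (simp add: lorentz_def algebra_simps)

text \<open>The complement of a timelike vector is spacelike, by Cauchy-Schwarz in the first two
  coordinates. As the form is indefinite, this replaces the inference from \<open>norm v = 0\<close>
  to \<open>v = 0\<close>.\<close>

lemma lorentz_orthogonal_timelike:
  assumes "lorentz x x < 0" "lorentz x v = 0" "lorentz v v \<le> 0"
  shows "v = 0"
proof -
  let ?A = "(x$1)^2 + (x$2)^2" and ?B = "(v$1)^2 + (v$2)^2"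
  have 1: "?A < (x$3)^2" "?B \<le> (v$3)^2" "x$1 * v$1 + x$2 * v$2 = x$3 * v$3"
    using assms by (auto simp: lorentz_def power2_eq_square)
  have "(x$1 * v$1 + x$2 * v$2)^2 \<le> ?A * ?B"
    using zero_le_power2[of "x$1 * v$2 - x$2 * v$1"] by (simp add: power2_eq_square algebra_simps)
  then have 2: "(x$3)^2 * (v$3)^2 \<le> ?A * ?B" using 1(3) by (simp add: power_mult_distrib)
  also have "\<dots> \<le> ?A * (v$3)^2" using 1(2) by (intro mult_left_mono) auto
  finally have "((x$3)^2 - ?A) * (v$3)^2 \<le> 0" by (simp add: algebra_simps)
  then have "v$3 = 0" using 1(1) by (auto simp: mult_le_0_iff)
  with 1(2) have "v$1 = 0" "v$2 = 0"
    by (auto simp: sum_power2_le_zero_iff)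
  with \<open>v$3 = 0\<close> show ?thesis by (simp add: vec_eq_iff forall_3)
qed

text \<open>Reversed Cauchy-Schwarz on the upper sheet; it puts the argument of
  \<open>arcosh\<close> into the range where \<open>cosh\<close> inverts it.\<close>

lemma lorentz_ge_1:
  assumes "lorentz x x = -1" "lorentz y y = -1" "x$3 > 0" "y$3 > 0"
  shows "- lorentz x y \<ge> 1"
proof -
  let ?A = "(x$1)^2 + (x$2)^2" and ?B = "(y$1)^2 + (y$2)^2" and ?s = "x$1 * y$1 + x$2 * y$2"
  have 1: "(x$3)^2 = 1 + ?A" "(y$3)^2 = 1 + ?B"
    using assms by (auto simp: lorentz_def power2_eq_square)
  \<comment> \<open>The right side exceeds the left by the sum of the three squares whose
    nonnegativity is used here.\<close>
  have "(1 + ?s)^2 \<le> (1 + ?A) * (1 + ?B)"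
    using zero_le_power2[of "x$1 * y$2 - x$2 * y$1"] zero_le_power2[of "x$1 - y$1"] zero_le_power2[of "x$2 - y$2"]
    by (simp add: power2_eq_square algebra_simps)
  also have "\<dots> = (x$3 * y$3)^2" using 1 by (simp add: power_mult_distrib)
  finally have "1 + ?s \<le> x$3 * y$3"
    using assms by (auto dest: power2_le_imp_le)
  then show ?thesis by (simp add: lorentz_def)
qed

text \<open>Again \<open>b + c\<close> is a multiple of \<open>x\<close>, now with factor
  \<open>2 * cosh (D/2)\<close>. A vanishing Lorentz square does not suffice for this, so the
  difference is also shown to be orthogonal to the timelike vector \<open>x\<close>.\<close>

lemma hyperbolic_midpoint:
  assumes a: "lorentz a a = -1" "a$3 > 0" and b: "lorentz b b = -1" "b$3 > 0"
    and c: "lorentz c c = -1" "c$3 > 0" and x: "lorentz x x = -1" "x$3 > 0"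
    and xb: "arcosh (- lorentz x b) = arcosh (- lorentz b c) / 2"
    and xc: "arcosh (- lorentz x c) = arcosh (- lorentz b c) / 2"
  shows "cosh (arcosh (- lorentz x a)) * cosh (arcosh (- lorentz b c) / 2)
    = cosh ((arcosh (- lorentz a b) + arcosh (- lorentz a c)) / 2) *
      cosh ((arcosh (- lorentz a b) - arcosh (- lorentz a c)) / 2)"
proof -
  define h where "h = cosh (arcosh (- lorentz b c) / 2)"
  have cc: "cosh (arcosh (- lorentz u v)) = - lorentz u v" 
    if "lorentz u u = -1" "u$3 > 0" "lorentz v v = -1" "v$3 > 0" for u v
    using lorentz_ge_1[of u v] that by (simp add: cosh_arcosh_real)
  have h: "lorentz x b = - h" "lorentz x c = - h" 
    using cc[OF x b] cc[OF x c] xb xc unfolding h_def by auto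
  have h': "lorentz b x = - h" "lorentz c x = - h"
    using h lorentz_commute[of x] by simp_all
  have bc: "lorentz b c = 1 - 2 * h\<^sup>2"
    using cc[OF b c] cosh_double_cosh[of "arcosh (- lorentz b c) / 2"] by (simp add: h_def)
  have bc': "lorentz c b = 1 - 2 * h\<^sup>2" using bc lorentz_commute[of b c] by simp
  have "b + c - (2 * h) *\<^sub>R x = 0"
  proof (rule lorentz_orthogonal_timelike)
    show "lorentz x x < 0" using x by simp
    show "lorentz x (b + c - (2 * h) *\<^sub>R x) = 0" using h x by (simp add: lorentz_simps)
    show "lorentz (b + c - (2 * h) *\<^sub>R x) (b + c - (2 * h) *\<^sub>R x) \<le> 0"
      using h h' x b c bc bc' by (simp add: lorentz_simps algebra_simps power2_eq_square)
  qed
  then have "b + c = (2 * h) *\<^sub>R x" by simp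
  then have "lorentz a b + lorentz a c = 2 * h * lorentz x a" 
    using lorentz_simps(2)[of a b c] by (simp add: lorentz_simps lorentz_commute[of a x])
  moreover have "cosh u + cosh v = 2 * cosh ((u + v) / 2) * cosh ((u - v) / 2)" for u v :: real
    using cosh_add[of "(u + v) / 2" "(u - v) / 2"] cosh_diff[of "(u + v) / 2" "(u - v) / 2"]
    by (simp add: field_simps)
  note this[of "arcosh (- lorentz a b)" "arcosh (- lorentz a c)"]
  moreover have "2 * (- lorentz x a * h) = - (2 * h * lorentz x a)" by simp
  ultimately have "2 * (- lorentz x a * h) = 2 * (cosh ((arcosh (- lorentz a b) + arcosh (- lorentz a c)) / 2) *
      cosh ((arcosh (- lorentz a b) - arcosh (- lorentz a c)) / 2))"
    using cc[OF a b] cc[OF a c] by linarith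
  then show ?thesis unfolding cc[OF x a] h_def[symmetric] by linarith
qed

text \<open>This is the median length formula, arranged so that the triangle inequality decides the
  sign of the last term.\<close>

lemma euclidean_midpoint:
  fixes a b c x :: "'a::real_inner"
  assumes xb: "dist x b = dist b c / 2" and xc: "dist x c = dist b c / 2"
  shows "(dist x a)\<^sup>2 = ((dist a b + dist a c) / 2)\<^sup>2 + ((dist a b - dist a c)\<^sup>2 - (dist b c)\<^sup>2) / 4"
proof -
  \<comment> \<open>Equality in the triangle inequality makes \<open>b - x\<close> and
    \<open>x - c\<close> point the same way; having equal length, they coincide.\<close>
  have "dist b c = norm ((b - x) + (x - c))" "norm (b - x) = dist b c / 2" "norm (x - c) = dist b c / 2"
    using assms by (auto simp: dist_norm norm_minus_commute)
  then have "norm (b - x + (x - c)) = norm (b - x) + norm (x - c)" by linarith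
  then have "norm (b - x) *\<^sub>R (x - c) = norm (x - c) *\<^sub>R (b - x)" by (rule iffD1[OF norm_triangle_eq])
  then have "dist b c = 0 \<or> x - c = b - x"
    using \<open>norm (b - x) = _\<close> \<open>norm (x - c) = _\<close> by auto
  then have "x - c = b - x" using assms by auto
  then have b: "b = 2 *\<^sub>R x - c" by (simp add: algebra_simps scaleR_2)
  have d: "(dist u v)\<^sup>2 = (u - v) \<bullet> (u - v)" for u v :: 'a
    by (simp add: dist_norm power2_norm_eq_inner)
  have "(dist x a)\<^sup>2 = ((dist a b)\<^sup>2 + (dist a c)\<^sup>2) / 2 - (dist b c)\<^sup>2 / 4"
    unfolding d b by (simp add: inner_diff inner_commute algebra_simps add_divide_distrib diff_divide_distrib)
  then show ?thesis by (simp add: power2_eq_square field_simps)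
qed

text \<open>By \<open>tri\<close>, the factor \<open>cos t\<close> in the product formula is at
  least \<open>cos D\<close> in the halved notation of the proof. The bounds on
  \<open>arccos (b \<bullet> c)\<close> and on the sum keep \<open>D\<close> and \<open>s\<close>
  below a right angle, so that these cosines are positive and can be cancelled.\<close>

lemma spherical_midpoint_le:
  fixes a b c x :: "'a::real_inner"
  assumes n: "norm a = 1" "norm b = 1" "norm c = 1" "norm x = 1"
    and D: "arccos (b \<bullet> c) < pi"
    and xb: "arccos (x \<bullet> b) = arccos (b \<bullet> c) / 2" and xc: "arccos (x \<bullet> c) = arccos (b \<bullet> c) / 2"
    and tri: "\<bar>arccos (a \<bullet> b) - arccos (a \<bullet> c)\<bar> \<le> arccos (b \<bullet> c)"
    and sum: "arccos (a \<bullet> b) + arccos (a \<bullet> c) < pi"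
  shows "arccos (x \<bullet> a) \<le> (arccos (a \<bullet> b) + arccos (a \<bullet> c)) / 2"
    and "\<bar>arccos (a \<bullet> b) - arccos (a \<bullet> c)\<bar> < arccos (b \<bullet> c) \<Longrightarrow>
      arccos (x \<bullet> a) < (arccos (a \<bullet> b) + arccos (a \<bullet> c)) / 2"
proof -
  define s t D where "s = (arccos (a \<bullet> b) + arccos (a \<bullet> c)) / 2"
    and "t = (arccos (a \<bullet> b) - arccos (a \<bullet> c)) / 2" and "D = arccos (b \<bullet> c) / 2"
  note eq = spherical_midpoint[OF n xb xc, folded s_def t_def D_def]
  have s: "0 \<le> s" "s < pi / 2" and e: "0 \<le> arccos (x \<bullet> a)" "arccos (x \<bullet> a) \<le> pi"
    and t: "\<bar>t\<bar> \<le> D" and D': "0 \<le> D" "D < pi / 2"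
    using tri sum D n by (auto simp: s_def t_def D_def arccos_inner_bounds)
  have pos: "cos s > 0" "cos D > 0" using s D' by (auto intro: cos_gt_zero_pi)
  have "cos D \<le> cos \<bar>t\<bar>" using t D' by (intro cos_monotone_0_pi_le) auto
  then have "cos s * cos D \<le> cos (arccos (x \<bullet> a)) * cos D" using eq pos by simp
  then have "cos s \<le> cos (arccos (x \<bullet> a))" using pos by simp
  then show "arccos (x \<bullet> a) \<le> (arccos (a \<bullet> b) + arccos (a \<bullet> c)) / 2"
    unfolding s_def[symmetric] using s e by (subst (asm) cos_mono_le_eq) auto
  assume "\<bar>arccos (a \<bullet> b) - arccos (a \<bullet> c)\<bar> < arccos (b \<bullet> c)"
  then have "\<bar>t\<bar> < D" by (simp add: t_def D_def)
  then have "cos D < cos \<bar>t\<bar>" using D' by (intro cos_monotone_0_pi) auto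
  then have "cos s * cos D < cos (arccos (x \<bullet> a)) * cos D" using eq pos by simp
  then have "cos s < cos (arccos (x \<bullet> a))" using pos by simp
  then show "arccos (x \<bullet> a) < (arccos (a \<bullet> b) + arccos (a \<bullet> c)) / 2"
    unfolding s_def[symmetric] using s e by (subst (asm) cos_mono_less_eq) auto
qed

text \<open>With \<open>a\<close> a midpoint too, the product formula has the factor
  \<open>cos (D/2)\<close> on both sides and \<open>cos 0\<close> as the rest.\<close>

lemma spherical_midpoint_unique:
  fixes a b c x :: "'a::real_inner"
  assumes n: "norm a = 1" "norm b = 1" "norm c = 1" "norm x = 1"
    and D: "arccos (b \<bullet> c) < pi"
    and xb: "arccos (x \<bullet> b) = arccos (b \<bullet> c) / 2" and xc: "arccos (x \<bullet> c) = arccos (b \<bullet> c) / 2"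
    and ab: "arccos (a \<bullet> b) = arccos (b \<bullet> c) / 2" and ac: "arccos (a \<bullet> c) = arccos (b \<bullet> c) / 2"
  shows "arccos (x \<bullet> a) = 0"
proof -
  have "cos (arccos (b \<bullet> c) / 2) > 0"
    using arccos_inner_bounds(1)[OF n(2,3)] D by (intro cos_gt_zero_pi) auto
  then have "cos (arccos (x \<bullet> a)) = 1"
    using spherical_midpoint[OF n xb xc] unfolding ab ac by simp
  then show ?thesis using arccos_inner_bounds[OF n(4,1)] by simp
qed

text \<open>Unlike \<open>cos\<close>, \<open>cosh\<close> increases with the length and is positive
  everywhere, so no bound on the size of the triangle enters.\<close>

lemma hyperbolic_midpoint_le:
  assumes a: "lorentz a a = -1" "a$3 > 0" and b: "lorentz b b = -1" "b$3 > 0"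
    and c: "lorentz c c = -1" "c$3 > 0" and x: "lorentz x x = -1" "x$3 > 0"
    and xb: "arcosh (- lorentz x b) = arcosh (- lorentz b c) / 2"
    and xc: "arcosh (- lorentz x c) = arcosh (- lorentz b c) / 2"
    and tri: "\<bar>arcosh (- lorentz a b) - arcosh (- lorentz a c)\<bar> \<le> arcosh (- lorentz b c)"
  shows "arcosh (- lorentz x a) \<le> (arcosh (- lorentz a b) + arcosh (- lorentz a c)) / 2"
    and "\<bar>arcosh (- lorentz a b) - arcosh (- lorentz a c)\<bar> < arcosh (- lorentz b c) \<Longrightarrow>
      arcosh (- lorentz x a) < (arcosh (- lorentz a b) + arcosh (- lorentz a c)) / 2"
proof -
  define s t D where "s = (arcosh (- lorentz a b) + arcosh (- lorentz a c)) / 2"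
    and "t = (arcosh (- lorentz a b) - arcosh (- lorentz a c)) / 2" and "D = arcosh (- lorentz b c) / 2"
  note eq = hyperbolic_midpoint[OF a b c x xb xc, folded s_def t_def D_def]
  have nn: "0 \<le> arcosh (- lorentz u v)"
    if "lorentz u u = -1" "u$3 > 0" "lorentz v v = -1" "v$3 > 0" for u v
    using lorentz_ge_1[of u v] that by (intro arcosh_nonneg_real) auto
  have s: "0 \<le> s" and e: "0 \<le> arcosh (- lorentz x a)" and t: "\<bar>t\<bar> \<le> D"
    using tri nn[OF a b] nn[OF a c] nn[OF x a] by (auto simp: s_def t_def D_def)
  have pos: "cosh s > 0" "cosh D > 0" by (auto simp: cosh_real_pos)
  have "cosh \<bar>t\<bar> \<le> cosh D" using t by (subst cosh_real_nonneg_le_iff) auto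
  then have "cosh (arcosh (- lorentz x a)) * cosh D \<le> cosh s * cosh D" using eq pos by simp
  then have "cosh (arcosh (- lorentz x a)) \<le> cosh s" using pos by simp
  then show "arcosh (- lorentz x a) \<le> (arcosh (- lorentz a b) + arcosh (- lorentz a c)) / 2"
    unfolding s_def[symmetric] using s e by (subst (asm) cosh_real_nonneg_le_iff) auto
  assume "\<bar>arcosh (- lorentz a b) - arcosh (- lorentz a c)\<bar> < arcosh (- lorentz b c)"
  then have "\<bar>t\<bar> < D" by (simp add: t_def D_def)
  then have "cosh \<bar>t\<bar> < cosh D" by (subst cosh_real_nonneg_less_iff) auto
  then have "cosh (arcosh (- lorentz x a)) * cosh D < cosh s * cosh D" using eq pos by simp
  then have "cosh (arcosh (- lorentz x a)) < cosh s" using pos by simp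
  then show "arcosh (- lorentz x a) < (arcosh (- lorentz a b) + arcosh (- lorentz a c)) / 2"
    unfolding s_def[symmetric] using s e by (subst (asm) cosh_real_nonneg_less_iff) auto
qed

lemma hyperbolic_midpoint_unique:
  assumes a: "lorentz a a = -1" "a$3 > 0" and b: "lorentz b b = -1" "b$3 > 0"
    and c: "lorentz c c = -1" "c$3 > 0" and x: "lorentz x x = -1" "x$3 > 0"
    and xb: "arcosh (- lorentz x b) = arcosh (- lorentz b c) / 2"
    and xc: "arcosh (- lorentz x c) = arcosh (- lorentz b c) / 2"
    and ab: "arcosh (- lorentz a b) = arcosh (- lorentz b c) / 2"
    and ac: "arcosh (- lorentz a c) = arcosh (- lorentz b c) / 2"
  shows "arcosh (- lorentz x a) = 0"
proof -
  have "cosh (arcosh (- lorentz x a)) = 1"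
    using hyperbolic_midpoint[OF a b c x xb xc] unfolding ab ac
    by (simp add: cosh_real_pos[THEN less_imp_neq, THEN not_sym])
  then show ?thesis using lorentz_ge_1[OF x(1) a(1) x(2) a(2)] by simp
qed

lemma euclidean_midpoint_le:
  fixes a b c x :: "'a::real_inner"
  assumes xb: "dist x b = dist b c / 2" and xc: "dist x c = dist b c / 2"
    and tri: "\<bar>dist a b - dist a c\<bar> \<le> dist b c"
  shows "dist x a \<le> (dist a b + dist a c) / 2"
    and "\<bar>dist a b - dist a c\<bar> < dist b c \<Longrightarrow> dist x a < (dist a b + dist a c) / 2"
proof -
  note eq = euclidean_midpoint[OF xb xc, of a]
  have "(dist a b - dist a c)\<^sup>2 \<le> (dist b c)\<^sup>2"
    using tri by (simp add: abs_le_square_iff[symmetric])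
  then have "(dist x a)\<^sup>2 \<le> ((dist a b + dist a c) / 2)\<^sup>2" using eq by simp
  then show "dist x a \<le> (dist a b + dist a c) / 2" by (rule power2_le_imp_le) simp
  assume "\<bar>dist a b - dist a c\<bar> < dist b c"
  then have "\<bar>dist a b - dist a c\<bar>\<^sup>2 < (dist b c)\<^sup>2" by (intro power_strict_mono) auto
  then have "(dist x a)\<^sup>2 < ((dist a b + dist a c) / 2)\<^sup>2" using eq by simp
  then show "dist x a < (dist a b + dist a c) / 2" by (rule power2_less_imp_less) simp
qed

lemma euclidean_midpoint_unique:
  fixes a b c x :: "'a::real_inner"
  assumes xb: "dist x b = dist b c / 2" and xc: "dist x c = dist b c / 2"
    and ab: "dist a b = dist b c / 2" and ac: "dist a c = dist b c / 2"
  shows "dist x a = 0"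
  using euclidean_midpoint[OF xb xc, of a] unfolding ab ac by (simp add: power2_eq_square)

section \<open>Midpoint estimates for every curvature, by rescaling to curvature 1, 0 or -1\<close>

lemma model_surface_spherical:
  assumes "k > 0" "a \<in> model_surface k"
  shows "norm (sqrt k *\<^sub>R a) = 1"
  using assms by (simp add: model_surface_def)

lemma model_dist_spherical:
  assumes "k > 0"
  shows "model_dist k a b = arccos ((sqrt k *\<^sub>R a) \<bullet> (sqrt k *\<^sub>R b)) / sqrt k"
  using assms by (simp add: model_dist_def mult.assoc[symmetric])

lemma model_surface_hyperbolic:
  assumes "k < 0" "a \<in> model_surface k"
  shows "lorentz (sqrt (-k) *\<^sub>R a) (sqrt (-k) *\<^sub>R a) = -1" "(sqrt (-k) *\<^sub>R a) $ 3 > 0"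
  using assms by (auto simp: model_surface_def lorentz_simps mult.assoc[symmetric])

lemma model_dist_hyperbolic:
  assumes "k < 0"
  shows "model_dist k a b = arcosh (- lorentz (sqrt (-k) *\<^sub>R a) (sqrt (-k) *\<^sub>R b)) / sqrt (-k)"
  using assms by (simp add: model_dist_def lorentz_simps mult.assoc[symmetric])

text \<open>Each sign of \<open>k\<close> reduces to its unit model. In the comparison argument
  \<open>tri\<close> is inherited from the space under study, whose side lengths agree with those of
  the model triangle.\<close>

lemma model_midpoint_le:
  assumes mem: "a \<in> model_surface k" "b \<in> model_surface k" "c \<in> model_surface k" "x \<in> model_surface k"
    and D: "k > 0 \<Longrightarrow> sqrt k * model_dist k b c < pi"
    and xb: "model_dist k x b = model_dist k b c / 2" and xc: "model_dist k x c = model_dist k b c / 2"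
    and tri: "\<bar>model_dist k a b - model_dist k a c\<bar> \<le> model_dist k b c"
    and sum: "k > 0 \<Longrightarrow> sqrt k * (model_dist k a b + model_dist k a c) < pi"
  shows "model_dist k x a \<le> (model_dist k a b + model_dist k a c) / 2 \<and>
    (\<bar>model_dist k a b - model_dist k a c\<bar> < model_dist k b c \<longrightarrow>
      model_dist k x a < (model_dist k a b + model_dist k a c) / 2)"
proof (cases k "0::real" rule: linorder_cases)
  case equal
  then show ?thesis
    using euclidean_midpoint_le[of x b c a] xb xc tri by (simp add: model_dist_def)
next
  case greater
  then have s: "sqrt k > 0" by simp
  note m = mem[THEN model_surface_spherical[OF greater]] and d = model_dist_spherical[OF greater]
  show ?thesis
    using spherical_midpoint_le[OF m] D[OF greater] xb xc tri sum[OF greater] s unfolding d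
    \<comment> \<open>The common denominator is first collected outside sums, differences and
      absolute values, so that it can then be cleared.\<close>
    by (simp only: diff_divide_distrib[symmetric] add_divide_distrib[symmetric] abs_divide)
       (simp add: divide_simps split: if_splits)
next
  case less
  then have s: "sqrt (-k) > 0" by simp
  note m = mem[THEN model_surface_hyperbolic(1)[OF less]] mem[THEN model_surface_hyperbolic(2)[OF less]]
  note d = model_dist_hyperbolic[OF less]
  show ?thesis
    using hyperbolic_midpoint_le[OF m(1,5,2,6,3,7,4,8)] xb xc tri s unfolding d
    by (simp only: diff_divide_distrib[symmetric] add_divide_distrib[symmetric] abs_divide)
       (simp add: divide_simps split: if_splits)
qed

lemma model_midpoint_unique:
  assumes mem: "a \<in> model_surface k" "b \<in> model_surface k" "c \<in> model_surface k" "x \<in> model_surface k"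
    and D: "k > 0 \<Longrightarrow> sqrt k * model_dist k b c < pi"
    and xb: "model_dist k x b = model_dist k b c / 2" and xc: "model_dist k x c = model_dist k b c / 2"
    and ab: "model_dist k a b = model_dist k b c / 2" and ac: "model_dist k a c = model_dist k b c / 2"
  shows "model_dist k x a = 0"
proof (cases k "0::real" rule: linorder_cases)
  case equal
  then show ?thesis
    using euclidean_midpoint_unique[of x b c a] xb xc ab ac by (simp add: model_dist_def)
next
  case greater
  then have s: "sqrt k > 0" by simp
  note m = mem[THEN model_surface_spherical[OF greater]] and d = model_dist_spherical[OF greater]
  show ?thesis
    using spherical_midpoint_unique[OF m] D[OF greater] xb xc ab ac s unfolding d
    by (simp add: divide_simps split: if_splits)
next
  case less
  then have s: "sqrt (-k) > 0" by simp
  note m = mem[THEN model_surface_hyperbolic(1)[OF less]] mem[THEN model_surface_hyperbolic(2)[OF less]]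
  note d = model_dist_hyperbolic[OF less]
  show ?thesis
    using hyperbolic_midpoint_unique[OF m(1,5,2,6,3,7,4,8)] xb xc ab ac s unfolding d
    by (simp add: divide_simps split: if_splits)
qed

lemma model_dist_commute: "model_dist k x y = model_dist k y x"
  by (simp add: model_dist_def inner_commute dist_commute lorentz_commute)

section \<open>Geodesics in CAT(k) spaces\<close>

lemma geodesic_path_dist:
  "geodesic_path M d \<gamma> x y \<Longrightarrow> s \<in> {0..1} \<Longrightarrow> t \<in> {0..1} \<Longrightarrow> d (\<gamma> s) (\<gamma> t) = \<bar>s - t\<bar> * d x y"
  by (simp add: geodesic_path_def)

text \<open>Makes the midpoint of any two parameters the parameter \<open>1/2\<close> of a geodesic,
  where comparison is available. The order of \<open>u\<close> and \<open>v\<close> is free, so the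
  subpath may run backwards.\<close>

lemma geodesic_path_sub:
  assumes "geodesic_path M d \<gamma> x y" "u \<in> {0..1}" "v \<in> {0..1}"
  shows "geodesic_path M d (\<lambda>t. \<gamma> (u + t * (v - u))) (\<gamma> u) (\<gamma> v)"
proof -
  have *: "u + t * (v - u) \<in> {0..1}" if "t \<in> {0..1}" for t
    using convexD_alt[of "{0..1}" u v t] assms that by (auto simp: algebra_simps)
  have "d (\<gamma> (u + s * (v - u))) (\<gamma> (u + t * (v - u))) = \<bar>s - t\<bar> * d (\<gamma> u) (\<gamma> v)"
    if "s \<in> {0..1}" "t \<in> {0..1}" for s t
  proof -
    have "(u + s * (v - u)) - (u + t * (v - u)) = (t - s) * (u - v)" by (simp add: algebra_simps)
    then have "\<bar>(u + s * (v - u)) - (u + t * (v - u))\<bar> = \<bar>s - t\<bar> * \<bar>u - v\<bar>"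
      by (simp add: abs_mult abs_minus_commute)
    then show ?thesis using assms *[OF that(1)] *[OF that(2)] by (simp add: geodesic_path_def)
  qed
  then show ?thesis using assms * by (auto simp: geodesic_path_def image_subset_iff)
qed

text \<open>The comparison condition at parameter \<open>1/2\<close>. The conclusion records
  distances only, which is the form that the midpoint estimates accept.\<close>

lemma CAT_midpoint:
  assumes CAT: "CAT M d k" and mem: "a \<in> M" "b \<in> M" "c \<in> M"
    and \<gamma>: "geodesic_path M d \<gamma> b c"
    and per: "k > 0 \<Longrightarrow> sqrt k * (d a b + d b c + d c a) < 2 * pi"
  obtains a' b' c' x' where "a' \<in> model_surface k" "b' \<in> model_surface k" "c' \<in> model_surface k"
    "x' \<in> model_surface k"
    "model_dist k a' b' = d a b" "model_dist k a' c' = d a c" "model_dist k b' c' = d b c"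
    "model_dist k x' b' = d b c / 2" "model_dist k x' c' = d b c / 2"
    "d a (\<gamma> (1/2)) \<le> model_dist k x' a'"
proof -
  interpret Metric_space M d using CAT by (simp add: CAT_def geodesic_space_def)
  have "ereal (d a b + d b c + d c a) < ereal (2 * pi) / ereal (sqrt (max k 0))"
  proof (cases "k > 0")
    case True
    then show ?thesis using per by (simp add: max_def pos_less_divide_eq mult.commute)
  next
    \<comment> \<open>Here the perimeter bound is \<open>2 * pi / 0\<close>, which is infinite in
      \<open>ereal\<close>.\<close>
    case False
    then show ?thesis by (simp add: max_def zero_ereal_def[symmetric] divide_ereal_def)
  qed
  moreover have "geodesic_segment M d (\<gamma> ` {0..1}) b c" using \<gamma> by (auto simp: geodesic_segment_def)
  ultimately obtain a' b' c' S' where abc: "a' \<in> model_surface k" "b' \<in> model_surface k" "c' \<in> model_surface k"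
    and eq: "model_dist k a' b' = d a b" "model_dist k b' c' = d b c" "model_dist k c' a' = d c a"
    and S': "geodesic_segment (model_surface k) (model_dist k) S' b' c'"
    and le: "\<And>x x'. x \<in> \<gamma> ` {0..1} \<Longrightarrow> x' \<in> S' \<Longrightarrow> d b x = model_dist k b' x' \<Longrightarrow> d x a \<le> model_dist k x' a'"
    using CAT mem unfolding CAT_def by blast
  obtain \<gamma>' where \<gamma>': "geodesic_path (model_surface k) (model_dist k) \<gamma>' b' c'" "S' = \<gamma>' ` {0..1}"
    using S' by (auto simp: geodesic_segment_def)
  have half: "\<gamma> (1/2) \<in> M" "d b (\<gamma> (1/2)) = d b c / 2" "\<gamma>' (1/2) \<in> model_surface k"
    "model_dist k b' (\<gamma>' (1/2)) = d b c / 2" "model_dist k (\<gamma>' (1/2)) c' = d b c / 2"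
    using geodesic_path_dist[OF \<gamma>, of 0 "1/2"] geodesic_path_dist[OF \<gamma>'(1), of 0 "1/2"]
      geodesic_path_dist[OF \<gamma>'(1), of "1/2" 1] \<gamma> \<gamma>'(1) eq
    by (simp_all add: geodesic_path_def image_subset_iff)
  show thesis
  proof
    show "d a (\<gamma> (1/2)) \<le> model_dist k (\<gamma>' (1/2)) a'"
      using le[of "\<gamma> (1/2)" "\<gamma>' (1/2)"] half mem \<gamma>' by (simp add: commute)
    show "model_dist k (\<gamma>' (1/2)) b' = d b c / 2" using half(4) by (simp add: model_dist_commute)
    show "model_dist k a' c' = d a c" using eq(3) by (simp add: model_dist_commute commute)
  qed (use abc eq half in auto)
qed

text \<open>The function is Lipschitz, with the sum of the two lengths as constant. A second path is
  allowed for comparing two geodesics; a constant one gives the distance from a point.\<close>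

lemma (in Metric_space) geodesic_path_dist_continuous:
  assumes g: "geodesic_path M d \<gamma> x y" and h: "geodesic_path M d \<eta> z w"
  shows "continuous_on {0..1} (\<lambda>t. d (\<gamma> t) (\<eta> t))"
proof -
  have "\<bar>d (\<gamma> s) (\<eta> s) - d (\<gamma> t) (\<eta> t)\<bar> \<le> (d x y + d z w) * \<bar>s - t\<bar>"
    if st: "s \<in> {0..1}" "t \<in> {0..1}" for s t
  proof -
    have "\<gamma> s \<in> M" "\<gamma> t \<in> M" "\<eta> s \<in> M" "\<eta> t \<in> M" 
      and "d (\<gamma> s) (\<gamma> t) = \<bar>s - t\<bar> * d x y" "d (\<eta> s) (\<eta> t) = \<bar>s - t\<bar> * d z w"
      using g h st by (auto simp: geodesic_path_def image_subset_iff)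
    moreover have "\<bar>d (\<gamma> s) (\<eta> s) - d (\<gamma> t) (\<eta> t)\<bar> \<le> d (\<gamma> s) (\<gamma> t) + d (\<eta> s) (\<eta> t)"
      using triangle[of "\<gamma> s" "\<gamma> t" "\<eta> s"] triangle[of "\<gamma> t" "\<eta> t" "\<eta> s"]
        triangle[of "\<gamma> t" "\<gamma> s" "\<eta> t"] triangle[of "\<gamma> s" "\<eta> s" "\<eta> t"] calculation(1-4)
      by (simp add: commute)
    ultimately show ?thesis by (simp add: algebra_simps)
  qed
  then have "(d x y + d z w)-lipschitz_on {0..1} (\<lambda>t. d (\<gamma> t) (\<eta> t))"
    by (intro lipschitz_onI) (auto simp: dist_real_def nonneg)
  then show ?thesis by (rule lipschitz_on_continuous_on)
qed

text \<open>The parameters at which the two paths agree form a closed set. For its stability under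
  midpoints, the midpoint of \<open>\<eta>\<close> serves as vertex opposite to a piece of
  \<open>\<gamma>\<close>: in the comparison triangle it becomes a second midpoint, and these
  coincide.\<close>

lemma CAT_geodesic_unique:
  assumes CAT: "CAT M d k" and g: "geodesic_path M d \<gamma> x y" and h: "geodesic_path M d \<eta> x y"
    and D: "k > 0 \<Longrightarrow> sqrt k * d x y < pi" and t: "t \<in> {0..1}"
  shows "\<gamma> t = \<eta> t"
proof -
  interpret Metric_space M d using CAT by (simp add: CAT_def geodesic_space_def)
  have M: "\<gamma> s \<in> M" "\<eta> s \<in> M" if "s \<in> {0..1}" for s
    using g h that by (auto simp: geodesic_path_def image_subset_iff)
  define T where "T = {s \<in> {0..1}. d (\<gamma> s) (\<eta> s) \<le> 0}"
  have T: "s \<in> T \<longleftrightarrow> s \<in> {0..1} \<and> \<gamma> s = \<eta> s" for s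
    using M[of s] nonneg[of "\<gamma> s" "\<eta> s"] zero[of "\<gamma> s" "\<eta> s"]
    by (force simp: T_def order_antisym_conv)
  have "closed T" unfolding T_def
    by (intro continuous_on_closed_Collect_le geodesic_path_dist_continuous[OF g h]) auto
  moreover have "0 \<in> T" "1 \<in> T" using g h by (auto simp: T geodesic_path_def)
  moreover have "(u + v) / 2 \<in> T" if uv: "u \<in> T" "v \<in> T" for u v
  proof -
    have uv01: "u \<in> {0..1}" "v \<in> {0..1}" "\<gamma> u = \<eta> u" "\<gamma> v = \<eta> v" using uv T by auto
    let ?m = "(u + v) / 2"
    have m: "?m \<in> {0..1}" and m_eq: "u + 1/2 * (v - u) = ?m" using uv01 by (auto simp: field_simps)
    note g' = geodesic_path_sub[OF g uv01(1,2)] and h' = geodesic_path_sub[OF h uv01(1,2)]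
    have "d (\<gamma> u) (\<gamma> v) = \<bar>u - v\<bar> * d x y" by (rule geodesic_path_dist[OF g uv01(1,2)])
    also have "\<dots> \<le> 1 * d x y" using uv01 by (intro mult_right_mono) auto
    finally have "d (\<gamma> u) (\<gamma> v) \<le> d x y" by simp
    then have le: "sqrt k * d (\<gamma> u) (\<gamma> v) < pi" if "k > 0"
      using le_less_trans[OF mult_left_mono D[OF that]] that by simp
    have half: "d (\<eta> ?m) (\<gamma> u) = d (\<gamma> u) (\<gamma> v) / 2" "d (\<eta> ?m) (\<gamma> v) = d (\<gamma> u) (\<gamma> v) / 2"
      using geodesic_path_dist[OF h', of "1/2" 0] geodesic_path_dist[OF h', of "1/2" 1]
      unfolding m_eq by (simp_all add: uv01(3,4))
    \<comment> \<open>The triangle is degenerate, with perimeter twice the side from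
      \<open>\<gamma> u\<close> to \<open>\<gamma> v\<close>.\<close>
    have "k > 0 \<Longrightarrow> sqrt k * (d (\<eta> ?m) (\<gamma> u) + d (\<gamma> u) (\<gamma> v) + d (\<gamma> v) (\<eta> ?m)) < 2 * pi"
      unfolding half commute[of "\<gamma> v"] using le by simp
    then obtain a' b' c' x' where *: "a' \<in> model_surface k" "b' \<in> model_surface k" "c' \<in> model_surface k"
      "x' \<in> model_surface k" "model_dist k a' b' = d (\<eta> ?m) (\<gamma> u)" "model_dist k a' c' = d (\<eta> ?m) (\<gamma> v)"
      "model_dist k b' c' = d (\<gamma> u) (\<gamma> v)" "model_dist k x' b' = d (\<gamma> u) (\<gamma> v) / 2"
      "model_dist k x' c' = d (\<gamma> u) (\<gamma> v) / 2" "d (\<eta> ?m) (\<gamma> (u + 1/2 * (v - u))) \<le> model_dist k x' a'"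
      using CAT_midpoint[OF CAT M(2)[OF m] M(1)[OF uv01(1)] M(1)[OF uv01(2)] g'] by blast
    have "model_dist k x' a' = 0"
      by (rule model_midpoint_unique[OF *(1-4)]) (use * half le in auto)
    with *(10) m show ?thesis unfolding m_eq T_def by (simp add: commute)
  qed
  ultimately have "{0..1} \<subseteq> T" by (rule midpoint_closed_real_interval)
  with t T show ?thesis by blast
qed

text \<open>Three sides below a right angle satisfy the perimeter bound and both size conditions of
  the model estimate.\<close>

lemma CAT_dist_midpoint:
  assumes CAT: "CAT M d k" and p: "p \<in> M" and g: "geodesic_path M d \<gamma> x y"
    and lt: "k > 0 \<Longrightarrow> sqrt k * d p x < pi / 2" "k > 0 \<Longrightarrow> sqrt k * d p y < pi / 2"
      "k > 0 \<Longrightarrow> sqrt k * d x y < pi / 2"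
  shows "d p (\<gamma> (1/2)) \<le> (d p x + d p y) / 2"
    and "\<not> radial d p x y \<Longrightarrow> d p (\<gamma> (1/2)) < (d p x + d p y) / 2"
proof -
  interpret Metric_space M d using CAT by (simp add: CAT_def geodesic_space_def)
  have M: "x \<in> M" "y \<in> M" using g by (auto simp: geodesic_path_def image_subset_iff)
  have "sqrt k * (d p x + d x y + d y p) < 2 * pi" if "k > 0"
    unfolding distrib_left commute[of y p] using lt[OF that] pi_gt_zero by linarith
  then obtain a' b' c' x' where *: "a' \<in> model_surface k" "b' \<in> model_surface k" "c' \<in> model_surface k"
      "x' \<in> model_surface k" "model_dist k a' b' = d p x" "model_dist k a' c' = d p y"
      "model_dist k b' c' = d x y" "model_dist k x' b' = d x y / 2"
      "model_dist k x' c' = d x y / 2" "d p (\<gamma> (1/2)) \<le> model_dist k x' a'"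
    using CAT_midpoint[OF CAT p M g] by blast
  have tri: "\<bar>d p x - d p y\<bar> \<le> d x y"
    using triangle[of p x y] triangle[of p y x] p M by (simp add: commute)
  have "sqrt k * d x y < pi" "sqrt k * (d p x + d p y) < pi" if "k > 0"
    unfolding distrib_left using lt[OF that] pi_gt_zero by linarith+
  then have le: "model_dist k x' a' \<le> (d p x + d p y) / 2"
    and less: "\<bar>d p x - d p y\<bar> < d x y \<Longrightarrow> model_dist k x' a' < (d p x + d p y) / 2"
    using model_midpoint_le[OF *(1-4)] tri unfolding *(5-9) by blast+
  show "d p (\<gamma> (1/2)) \<le> (d p x + d p y) / 2" using le * by simp
  show "d p (\<gamma> (1/2)) < (d p x + d p y) / 2" if "\<not> radial d p x y"
    using less tri that * by (simp add: radial_def)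
qed

text \<open>Midpoint convexity and continuity give convexity. A strict inequality at the single
  parameter \<open>1/2\<close> then spreads to all interior parameters by convexity on each
  half.\<close>

lemma CAT_dist_strictly_convex:
  assumes CAT: "CAT M d k" and p: "p \<in> A" and A: "A \<subseteq> M" and g: "geodesic_path M d \<gamma> x y"
    and gA: "\<gamma> ` {0..1} \<subseteq> A"
    and lt: "\<And>u v. k > 0 \<Longrightarrow> u \<in> A \<Longrightarrow> v \<in> A \<Longrightarrow> sqrt k * d u v < pi / 2"
  shows "convex_on {0..1} (\<lambda>t. d p (\<gamma> t))"
    and "\<not> radial d p x y \<Longrightarrow> t \<in> {0<..<1} \<Longrightarrow> d p (\<gamma> t) < (1 - t) * d p x + t * d p y"
proof -
  interpret Metric_space M d using CAT by (simp add: CAT_def geodesic_space_def)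
  have pM: "p \<in> M" using p A by auto
  have gs: "\<gamma> s \<in> A" if "s \<in> {0..1}" for s using gA that by auto
  have end01: "\<gamma> 0 = x" "\<gamma> 1 = y" using g by (auto simp: geodesic_path_def)
  have "geodesic_path M d (\<lambda>_. p) p p" using pM by (auto simp: geodesic_path_def)
  then have cont: "continuous_on {0..1} (\<lambda>t. d p (\<gamma> t))" by (rule geodesic_path_dist_continuous[OF _ g])
  have "d p (\<gamma> ((u + v) / 2)) \<le> (d p (\<gamma> u) + d p (\<gamma> v)) / 2" if uv: "u \<in> {0..1}" "v \<in> {0..1}" for u v
  proof -
    have m_eq: "u + 1/2 * (v - u) = (u + v) / 2" by (simp add: field_simps)
    show ?thesis
      using CAT_dist_midpoint(1)[OF CAT pM geodesic_path_sub[OF g uv]] lt p gs uv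
      unfolding m_eq by blast
  qed
  then show conv: "convex_on {0..1} (\<lambda>t. d p (\<gamma> t))" by (rule midpoint_convex_on[OF cont])
  assume "\<not> radial d p x y" and t: "t \<in> {0<..<1}"
  then have m: "d p (\<gamma> (1/2)) < (d p x + d p y) / 2"
    using CAT_dist_midpoint(2)[OF CAT pM g] lt p gs[of 0] gs[of 1] end01 by auto
  show "d p (\<gamma> t) < (1 - t) * d p x + t * d p y"
  \<comment> \<open>Between an end and \<open>1/2\<close>, the weight of \<open>1/2\<close> is
    \<open>2*t\<close> on the left half and \<open>1 - (2*t-1)\<close> on the right, positive in
    both cases.\<close>
  proof (cases "t \<le> 1/2")
    case True
    have "d p (\<gamma> ((1 - 2*t) *\<^sub>R 0 + (2*t) *\<^sub>R (1/2))) \<le> (1 - 2*t) * d p (\<gamma> 0) + (2*t) * d p (\<gamma> (1/2))"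
      by (rule convex_onD[OF conv]) (use t True in auto)
    then have "d p (\<gamma> t) \<le> (1 - 2*t) * d p x + (2*t) * d p (\<gamma> (1/2))" using end01 by simp
    also have "\<dots> < (1 - 2*t) * d p x + (2*t) * ((d p x + d p y) / 2)"
      using m t by (intro add_strict_left_mono mult_strict_left_mono) auto
    finally show ?thesis by (simp add: field_simps)
  next
    case False
    have "d p (\<gamma> ((1 - (2*t-1)) *\<^sub>R (1/2) + (2*t-1) *\<^sub>R 1)) \<le> (1 - (2*t-1)) * d p (\<gamma> (1/2)) + (2*t-1) * d p (\<gamma> 1)"
      by (rule convex_onD[OF conv]) (use t False in auto)
    then have "d p (\<gamma> t) \<le> (1 - (2*t-1)) * d p (\<gamma> (1/2)) + (2*t-1) * d p y"
      using end01 by (simp add: algebra_simps)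
    also have "\<dots> < (1 - (2*t-1)) * ((d p x + d p y) / 2) + (2*t-1) * d p y"
      using m t by (intro add_strict_right_mono mult_strict_left_mono) auto
    finally show ?thesis by (simp add: field_simps)
  qed
qed

section \<open>Lower bounds for the critical diameters in CAT(k) spaces\<close>

lemma dist_le_diam: "p \<in> A \<Longrightarrow> q \<in> A \<Longrightarrow> ereal (d p q) \<le> diam d A"
  unfolding diam_def by (meson SUP_upper SUP_upper2)

lemma critical_diam_geI:
  assumes "\<And>A. A \<subseteq> M \<Longrightarrow> diam d A < r \<Longrightarrow> A \<in> C"
  shows "r \<le> critical_diam M d C"
  unfolding critical_diam_def using assms by (intro Sup_upper) auto

lemma D_convex_ge:
  assumes CAT: "CAT M d k"
  shows "D_convex M d \<ge> ereal pi / (2 * ereal (sqrt (max k 0)))"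
  unfolding D_convex_def
proof (rule critical_diam_geI)
  fix A assume A: "A \<subseteq> M" and diam: "diam d A < ereal pi / (2 * ereal (sqrt (max k 0)))"
  \<comment> \<open>Only positive \<open>k\<close> gives a finite bound, and the size conditions
    above are asked for only in that case.\<close>
  have lt: "sqrt k * d u v < pi / 2" if "k > 0" "u \<in> A" "v \<in> A" for u v
  proof -
    have "ereal (d u v) < ereal (pi / (2 * sqrt k))"
      using le_less_trans[OF dist_le_diam[OF that(2,3)] diam] that(1) by (simp add: max_def)
    then show ?thesis using that(1) by (simp add: field_simps)
  qed
  show "A \<in> C_convex M d"
    unfolding C_convex_def
  proof (intro CollectI conjI ballI allI impI A)
    fix p x y \<gamma> assume *: "p \<in> A" "geodesic_path M d \<gamma> x y" "\<gamma> ` {0..1} \<subseteq> A"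
    show "convex_on {0..1} (\<lambda>t. d p (\<gamma> t))"
      by (rule CAT_dist_strictly_convex(1)[OF CAT *(1) A *(2,3) lt])
    show "d p (\<gamma> t) < (1 - t) * d p x + t * d p y" if "\<not> radial d p x y" "t \<in> {0<..<1}" for t
      by (rule CAT_dist_strictly_convex(2)[OF CAT *(1) A *(2,3) lt that])
  qed
qed

lemma D_geodesic_ge:
  assumes CAT: "CAT M d k"
  shows "D_geodesic M d \<ge> ereal pi / ereal (sqrt (max k 0))"
  unfolding D_geodesic_def
proof (rule critical_diam_geI)
  fix A assume A: "A \<subseteq> M" and diam: "diam d A < ereal pi / ereal (sqrt (max k 0))"
  have lt: "sqrt k * d u v < pi" if "k > 0" "u \<in> A" "v \<in> A" for u v
    using le_less_trans[OF dist_le_diam[OF that(2,3)] diam] that(1) by (simp add: max_def field_simps)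
  show "A \<in> C_geodesic M d"
    unfolding C_geodesic_def
  proof (intro CollectI conjI ballI A)
    fix p q assume pq: "p \<in> A" "q \<in> A"
    obtain \<gamma> where \<gamma>: "geodesic_path M d \<gamma> p q"
      using CAT A pq unfolding CAT_def geodesic_space_def by blast
    show "\<exists>!S. geodesic_segment M d S p q"
    proof
      show "geodesic_segment M d (\<gamma> ` {0..1}) p q" using \<gamma> by (auto simp: geodesic_segment_def)
      fix S assume "geodesic_segment M d S p q"
      then obtain \<eta> where \<eta>: "geodesic_path M d \<eta> p q" "S = \<eta> ` {0..1}"
        by (auto simp: geodesic_segment_def)
      show "S = \<gamma> ` {0..1}"
        unfolding \<eta>(2) by (rule image_cong[OF refl CAT_geodesic_unique[OF CAT \<eta>(1) \<gamma> lt[OF _ pq]]])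
    qed
  qed
qed

section \<open>Means on the sphere\<close>

text \<open>The reflection of \<open>m\<close> is
  \<open>m - 2 * (z \<bullet> m) *\<^sub>R z\<close>. The extra \<open>c\<close> in
  \<open>\<tau>\<close> goes beyond it, which gives a strict gain even for
  \<open>z \<bullet> m = 0\<close>.\<close>

lemma sphere_push_towards:
  fixes m z :: "'b::real_inner"
  assumes m: "norm m = 1" and z: "norm z = 1" and c: "c > 0" and zm: "z \<bullet> m \<le> 0"
  obtains m' where "norm m' = 1"
    "\<And>x. norm x = 1 \<Longrightarrow> c \<le> x \<bullet> z \<Longrightarrow> x \<bullet> m < x \<bullet> m'"
proof -
  define \<tau> where "\<tau> = c - 2 * (z \<bullet> m)"
  define N where "N = norm (m + \<tau> *\<^sub>R z)"
  have \<tau>: "\<tau> > 0" using c zm by (simp add: \<tau>_def)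
  have mm: "m \<bullet> m = 1" "z \<bullet> z = 1" using m z by (simp_all add: dot_square_norm)
  have "N\<^sup>2 = 1 + 2 * \<tau> * (z \<bullet> m) + \<tau> * \<tau>"
    unfolding N_def power2_norm_eq_inner by (simp add: inner_add mm inner_commute algebra_simps)
  also have "\<dots> = 1 + \<tau> * c" by (simp add: \<tau>_def algebra_simps)
  finally have N2: "N\<^sup>2 = 1 + \<tau> * c" .
  have tc: "\<tau> * c > 0" using \<tau> c by simp
  have "1\<^sup>2 < N\<^sup>2" using N2 tc by simp
  then have N1: "N > 1" by (rule power2_less_imp_less) (simp add: N_def)
  have "N\<^sup>2 < (1 + \<tau> * c)\<^sup>2" using N2 tc mult_pos_pos[OF tc tc]
    by (simp add: power2_eq_square algebra_simps)
  \<comment> \<open>Normalising by \<open>N\<close> costs \<open>(N - 1) * (x \<bullet> m)\<close>,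
    at most \<open>N - 1\<close> if \<open>x \<bullet> m\<close> is positive; the push gains at
    least \<open>\<tau> * c\<close>.\<close>
  then have Nle: "N - 1 < \<tau> * c" using power2_less_imp_less[of N "1 + \<tau> * c"] tc by simp
  show thesis
  proof
    show "norm ((1 / N) *\<^sub>R (m + \<tau> *\<^sub>R z)) = 1"
      using N1 by (simp add: N_def[symmetric])
  next
    fix x :: 'b assume x: "norm x = 1" and cx: "c \<le> x \<bullet> z"
    have "\<tau> * c \<le> \<tau> * (x \<bullet> z)" using \<tau> cx by (intro mult_left_mono) auto
    moreover have "(x \<bullet> m) * (N - 1) < \<tau> * c"
    proof (cases "x \<bullet> m \<le> 0")
      case True
      then show ?thesis using N1 tc mult_nonpos_nonneg[of "x \<bullet> m" "N - 1"] by simp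
    next
      case False
      then have "(x \<bullet> m) * (N - 1) \<le> 1 * (N - 1)"
        using abs_inner_le_1[OF x m] N1 by (intro mult_right_mono) auto
      then show ?thesis using Nle by simp
    qed
    ultimately have "(x \<bullet> m) * N < x \<bullet> (m + \<tau> *\<^sub>R z)" by (simp add: inner_add_right algebra_simps)
    then show "x \<bullet> m < x \<bullet> ((1 / N) *\<^sub>R (m + \<tau> *\<^sub>R z))"
      using N1 by (simp add: pos_less_divide_eq)
  qed
qed

text \<open>\<open>u\<close> gives unit-vector coordinates and \<open>\<kappa> * d x y\<close> is
  the angle between them, so curvature \<open>k\<close> corresponds to
  \<open>\<kappa> = sqrt k\<close>.\<close>

locale spherical_metric = Metric_space M d for M :: "'a set" and d +
  fixes \<kappa> :: real and u :: "'a \<Rightarrow> 'b::euclidean_space"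
  assumes \<kappa>_pos: "\<kappa> > 0"
    and u_bij: "bij_betw u M (sphere 0 1)"
    and arc: "x \<in> M \<Longrightarrow> y \<in> M \<Longrightarrow> \<kappa> * d x y = arccos (u x \<bullet> u y)"
begin

lemma norm_u: "x \<in> M \<Longrightarrow> norm (u x) = 1"
  using bij_betwE[OF u_bij] by auto

lemma u_surj: "norm v = 1 \<Longrightarrow> \<exists>x\<in>M. u x = v"
  using bij_betw_imp_surj_on[OF u_bij] by (force simp: image_iff)

lemma arc_le_pi: "x \<in> M \<Longrightarrow> y \<in> M \<Longrightarrow> \<kappa> * d x y \<le> pi"
  using arccos_inner_bounds(2)[OF norm_u norm_u] arc by simp

lemma cos_arc: "x \<in> M \<Longrightarrow> y \<in> M \<Longrightarrow> cos (\<kappa> * d x y) = u x \<bullet> u y"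
  using arccos_inner_bounds(3)[OF norm_u norm_u] arc by simp

lemma chord: "x \<in> M \<Longrightarrow> y \<in> M \<Longrightarrow> (dist (u x) (u y))\<^sup>2 = 2 - 2 * cos (\<kappa> * d x y)"
  by (simp add: dist_norm cos_arc norm_u dot_norm_neg field_simps)

text \<open>The chord of an angle \<open>t\<close> is \<open>2 * sin (t/2)\<close>, at most
  \<open>t\<close>; hence \<open>u\<close> is continuous.\<close>

lemma chord_le: "x \<in> M \<Longrightarrow> y \<in> M \<Longrightarrow> dist (u x) (u y) \<le> \<kappa> * d x y"
proof -
  assume xy: "x \<in> M" "y \<in> M"
  let ?t = "\<kappa> * d x y"
  have t: "?t \<ge> 0" using \<kappa>_pos by simp
  have "(dist (u x) (u y))\<^sup>2 = (2 * sin (?t / 2))\<^sup>2"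
    using chord[OF xy] cos_double_sin[of "?t / 2"] by (simp add: power2_eq_square)
  also have "\<dots> \<le> ?t\<^sup>2"
    using abs_sin_x_le_abs_x[of "?t / 2"] by (intro abs_le_square_iff[THEN iffD1]) (simp add: abs_mult)
  finally show ?thesis using t by (rule power2_le_imp_le)
qed

text \<open>Uniform continuity of the inverse of \<open>u\<close>, through which compactness and a
  countable basis pass from the Euclidean sphere to \<open>M\<close>. The angle is capped at
  \<open>pi\<close> to stay where \<open>cos\<close> is monotone.\<close>

lemma small_chord:
  assumes "r > 0"
  obtains e where "e > 0" "\<And>x y. x \<in> M \<Longrightarrow> y \<in> M \<Longrightarrow> dist (u x) (u y) < e \<Longrightarrow> d x y < r"
proof -
  define \<theta> where "\<theta> = min (\<kappa> * r) pi"
  have \<theta>: "0 < \<theta>" "\<theta> \<le> pi" "\<theta> \<le> \<kappa> * r" using assms \<kappa>_pos by (auto simp: \<theta>_def)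
  have "cos \<theta> < cos 0" using \<theta> by (intro cos_monotone_0_pi) auto
  then have pos: "2 - 2 * cos \<theta> > 0" by simp
  show thesis
  proof
    show "sqrt (2 - 2 * cos \<theta>) > 0" using pos by simp
  next
    fix x y assume xy: "x \<in> M" "y \<in> M" and "dist (u x) (u y) < sqrt (2 - 2 * cos \<theta>)"
    then have "(dist (u x) (u y))\<^sup>2 < (sqrt (2 - 2 * cos \<theta>))\<^sup>2" by (intro power_strict_mono) auto
    then have "cos \<theta> < cos (\<kappa> * d x y)" using chord[OF xy] pos by simp
    then have "\<kappa> * d x y < \<theta>"
      using \<theta> arc_le_pi[OF xy] \<kappa>_pos by (subst (asm) cos_mono_less_eq) auto
    then show "d x y < r" using \<theta> \<kappa>_pos by (meson le_less_trans less_le_trans mult_less_cancel_left_pos)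
  qed
qed

lemma openin_vimage:
  assumes "open U"
  shows "openin mtopology {x \<in> M. u x \<in> U}"
  unfolding openin_mtopology
proof safe
  fix x assume x: "x \<in> M" "u x \<in> U"
  then obtain e where e: "e > 0" "ball (u x) e \<subseteq> U" using assms open_contains_ball by blast
  have "mball x (e / \<kappa>) \<subseteq> {x \<in> M. u x \<in> U}"
  proof
    fix y assume "y \<in> mball x (e / \<kappa>)"
    then have y: "y \<in> M" "d x y < e / \<kappa>" by auto
    then have "\<kappa> * d x y < e" using \<kappa>_pos by (simp add: pos_less_divide_eq mult.commute)
    then have "dist (u x) (u y) < e" using chord_le[OF x(1) y(1)] by simp
    then show "y \<in> {x \<in> M. u x \<in> U}" using e y by auto
  qed
  then show "\<exists>r>0. mball x r \<subseteq> {x \<in> M. u x \<in> U}" using e \<kappa>_pos by (intro exI[of _ "e / \<kappa>"]) auto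
qed

section \<open>Expected distances, existence of means, and the mass of the support\<close>

context
  fixes P assumes P: "borel_prob M d P"
begin

interpretation prob_space P using P by (simp add: borel_prob_def)

lemma space_P: "space P = M" using P by (simp add: borel_prob_def)

lemma sets_open: "openin mtopology U \<Longrightarrow> U \<in> sets P"
  using P by (auto simp: borel_prob_def intro: sigma_sets.Basic)

lemma dist_measurable [measurable]: "m \<in> M \<Longrightarrow> (\<lambda>x. d x m) \<in> borel_measurable P"
  unfolding borel_measurable_iff_less
proof
  fix a assume m: "m \<in> M"
  have "{w \<in> space P. d w m < a} = mball m a" using m by (auto simp: space_P commute)
  then show "{w \<in> space P. d w m < a} \<in> sets P" by (simp add: sets_open)
qed

lemma dist_integrable: "m \<in> M \<Longrightarrow> integrable P (\<lambda>x. d x m)"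
proof (rule integrable_const_bound[where B = "pi / \<kappa>"])
  assume m: "m \<in> M"
  show "AE x in P. norm (d x m) \<le> pi / \<kappa>"
    using arc_le_pi[OF _ m] \<kappa>_pos
    by (intro AE_I2) (simp add: space_P pos_le_divide_eq mult.commute)
qed measurable

text \<open>Distances are bounded, so the expectations are finite reals that may be
  subtracted.\<close>

lemma is_L1_mean_iff:
  "is_L1_mean M d P m \<longleftrightarrow> m \<in> M \<and> (\<forall>m'\<in>M. (\<integral>x. d x m \<partial>P) \<le> (\<integral>x. d x m' \<partial>P))"
proof -
  have "(\<integral>\<^sup>+x. ennreal (d x m) \<partial>P) = ennreal (\<integral>x. d x m \<partial>P)" if "m \<in> M" for m
    using dist_integrable[OF that] by (intro nn_integral_eq_integral) auto
  then show ?thesis by (auto simp: is_L1_mean_def ennreal_le_iff integral_nonneg)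
qed

text \<open>The expected distance is 1-Lipschitz in the mean. Carried over to the unit sphere it is
  continuous by \<open>small_chord\<close> and attains its minimum by compactness.\<close>

lemma L1_mean_exists: "\<exists>m. is_L1_mean M d P m"
proof -
  define G where "G v = (\<integral>x. d x (inv_into M u v) \<partial>P)" for v
  have inv: "inv_into M u v \<in> M" "u (inv_into M u v) = v" if "v \<in> sphere 0 1" for v
    using bij_betw_imp_surj_on[OF u_bij] that inv_into_into[of v u M] f_inv_into_f[of v u M] by auto
  have lip: "\<bar>(\<integral>x. d x m \<partial>P) - (\<integral>x. d x m' \<partial>P)\<bar> \<le> d m m'" if m: "m \<in> M" "m' \<in> M" for m m'
  proof -
    have "\<bar>(\<integral>x. d x m \<partial>P) - (\<integral>x. d x m' \<partial>P)\<bar> = \<bar>\<integral>x. d x m - d x m' \<partial>P\<bar>"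
      using m by (simp add: dist_integrable)
    also have "\<dots> \<le> (\<integral>x. \<bar>d x m - d x m'\<bar> \<partial>P)" by (rule integral_abs_bound)
    also have "\<dots> \<le> (\<integral>x. d m m' \<partial>P)"
    proof (rule integral_mono)
      show "\<bar>d x m - d x m'\<bar> \<le> d m m'" if "x \<in> space P" for x
        using triangle[of x m m'] triangle[of x m' m] m that by (simp add: space_P commute)
    qed (use m in \<open>auto simp: dist_integrable\<close>)
    finally show ?thesis by (simp add: prob_space)
  qed
  have "continuous_on (sphere 0 1) G"
    unfolding continuous_on_iff
  proof (intro ballI allI impI)
    fix v :: 'b and r :: real assume v: "v \<in> sphere 0 1" and "r > 0"
    then obtain e where e: "e > 0" "\<And>x y. x \<in> M \<Longrightarrow> y \<in> M \<Longrightarrow> dist (u x) (u y) < e \<Longrightarrow> d x y < r"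
      using small_chord by blast
    have "dist (G w) (G v) < r" if w: "w \<in> sphere 0 1" "dist w v < e" for w
      using le_less_trans[OF lip[OF inv(1)[OF w(1)] inv(1)[OF v]] e(2)[OF inv(1)[OF w(1)] inv(1)[OF v]]]
      unfolding G_def dist_real_def inv(2)[OF w(1)] inv(2)[OF v] using w(2) by blast
    with e(1) show "\<exists>e>0. \<forall>w\<in>sphere 0 1. dist w v < e \<longrightarrow> dist (G w) (G v) < r" by blast
  qed
  moreover have "sphere (0::'b) 1 \<noteq> {}" by simp
  ultimately obtain v where v: "v \<in> sphere 0 1" "\<And>w. w \<in> sphere 0 1 \<Longrightarrow> G v \<le> G w"
    using continuous_attains_inf[of "sphere 0 1" G] by auto
  have "G (u m) = (\<integral>x. d x m \<partial>P)" if "m \<in> M" for m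
    using bij_betw_inv_into_left[OF u_bij that] by (simp add: G_def)
  then have "is_L1_mean M d P (inv_into M u v)"
    unfolding is_L1_mean_iff using v inv[OF v(1)] norm_u by (metis mem_sphere_0)
  then show ?thesis ..
qed

text \<open>Separability is what matters here: each point off the support has a null basic
  neighbourhood, and countably many of these cover the complement.\<close>

lemma AE_supp: "AE x in P. x \<in> supp M d P"
proof -
  obtain B :: "'b set set" where B: "countable B" "topological_basis B" using ex_countable_basis by blast
  let ?V = "\<lambda>b. {x \<in> M. u x \<in> b}"
  define B0 where "B0 = {b \<in> B. measure P (?V b) = 0}"
  have "(\<Union>b\<in>B0. ?V b) \<in> null_sets P"
  proof (rule null_sets_UN')
    show "countable B0" using B by (auto simp: B0_def intro: countable_subset)
    fix b assume b: "b \<in> B0"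
    then have "?V b \<in> sets P" using openin_vimage B by (auto simp: B0_def topological_basis_open intro!: sets_open)
    then show "?V b \<in> null_sets P" using b by (auto simp: B0_def null_sets_def emeasure_eq_measure)
  qed
  moreover have "{x \<in> space P. x \<notin> supp M d P} \<subseteq> (\<Union>b\<in>B0. ?V b)"
  proof
    fix x assume "x \<in> {x \<in> space P. x \<notin> supp M d P}"
    then obtain U where x: "x \<in> M" and U: "openin mtopology U" "x \<in> U" "measure P U \<le> 0"
      by (auto simp: space_P supp_def not_less)
    obtain r where r: "r > 0" "mball x r \<subseteq> U" using U openin_mtopology by blast
    obtain e where e: "e > 0" "\<And>x y. x \<in> M \<Longrightarrow> y \<in> M \<Longrightarrow> dist (u x) (u y) < e \<Longrightarrow> d x y < r"
      using small_chord[OF r(1)] by blast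
    obtain b where b: "b \<in> B" "u x \<in> b" "b \<subseteq> ball (u x) e"
      using topological_basisE[OF B(2) open_ball, of "u x" "u x" e] e(1) by auto
    have "?V b \<subseteq> U"
    proof
      fix y assume y: "y \<in> ?V b"
      then have "dist (u x) (u y) < e" using b by auto
      then show "y \<in> U" using y e(2)[OF x, of y] r x by auto
    qed
    then have "measure P (?V b) \<le> measure P U" using U by (intro finite_measure_mono sets_open)
    then have "measure P (?V b) = 0" using U(3) measure_nonneg[of P "?V b"] by linarith
    then have "b \<in> B0" using b by (simp add: B0_def)
    then show "x \<in> (\<Union>b\<in>B0. ?V b)" using x b by auto
  qed
  ultimately show ?thesis by (rule AE_I')
qed

section \<open>Location of the means and uniqueness unless the measure is evenly split\<close>

context
  fixes \<delta> :: real
  assumes \<delta>: "\<kappa> * \<delta> < pi / 2" 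
    and supp_diam: "\<And>x y. x \<in> supp M d P \<Longrightarrow> y \<in> supp M d P \<Longrightarrow> d x y \<le> \<delta>"
begin

lemma supp_M: "x \<in> supp M d P \<Longrightarrow> x \<in> M"
  by (simp add: supp_def)

text \<open>The positive number \<open>cos (\<kappa> * \<delta>)\<close> bounds
  \<open>u y \<bullet> u x\<close> from below for all support points \<open>y\<close> at once, so a
  single pushed point beats a far mean at each of them.\<close>

lemma L1_mean_near_supp:
  assumes m: "is_L1_mean M d P m" and x: "x \<in> supp M d P"
  shows "\<kappa> * d x m < pi / 2"
proof (rule ccontr)
  assume far: "\<not> \<kappa> * d x m < pi / 2"
  have mM: "m \<in> M" and xM: "x \<in> M" using m x by (auto simp: is_L1_mean_def supp_M)
  have "0 \<le> \<delta>" using supp_diam[OF x x] xM by simp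
  have "cos (\<kappa> * d x m) \<le> cos (pi / 2)"
    using far arc_le_pi[OF xM mM] by (intro cos_monotone_0_pi_le) auto
  then have "u x \<bullet> u m \<le> 0" using cos_arc[OF xM mM] by simp
  moreover have c: "cos (\<kappa> * \<delta>) > 0" using \<delta> \<kappa>_pos \<open>0 \<le> \<delta>\<close> 
    by (intro cos_gt_zero_pi) (auto intro: less_le_trans[of _ 0])
  ultimately obtain v where v: "norm v = 1"
      "\<And>w. norm w = 1 \<Longrightarrow> cos (\<kappa> * \<delta>) \<le> w \<bullet> u x \<Longrightarrow> w \<bullet> u m < w \<bullet> v"
    using sphere_push_towards[OF norm_u[OF mM] norm_u[OF xM]] by blast
  obtain m' where m': "m' \<in> M" "u m' = v" using u_surj v by blast
  have "d y m' < d y m" if y: "y \<in> supp M d P" for y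
  proof -
    have yM: "y \<in> M" using y supp_M by simp
    have "cos (\<kappa> * \<delta>) \<le> cos (\<kappa> * d y x)"
    proof (rule cos_monotone_0_pi_le)
      show "\<kappa> * \<delta> \<le> pi" using \<delta> pi_gt_zero by linarith
    qed (use supp_diam[OF y x] \<kappa>_pos in auto)
    then have "u y \<bullet> u m < u y \<bullet> u m'" using v(2)[OF norm_u[OF yM]] m' by (simp add: cos_arc yM xM)
    then have "\<kappa> * d y m' < \<kappa> * d y m"
      unfolding arc[OF yM m'(1)] arc[OF yM mM]
      using abs_inner_le_1[OF norm_u norm_u, OF yM m'(1)] abs_inner_le_1[OF norm_u norm_u, OF yM mM]
      by (intro arccos_less_arccos) auto
    then show ?thesis using \<kappa>_pos by simp
  qed
  then have "AE y in P. d y m' < d y m" using AE_supp by (auto elim: eventually_mono)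
  then have "(\<integral>y. d y m' \<partial>P) < (\<integral>y. d y m \<partial>P)"
    using m' mM emeasure_space_1 by (intro integral_less_AE_space dist_integrable) auto
  then show False using m m' by (auto simp: is_L1_mean_iff)
qed

lemma L1_mean_unique_or_evenly_split:
  assumes geod: "geodesic_space M d" and ne: "supp M d P \<noteq> {}"
    and m1: "is_L1_mean M d P m1" and m2: "is_L1_mean M d P m2" and neq: "m1 \<noteq> m2"
  shows "evenly_split M d P"
proof -
  have M: "m1 \<in> M" "m2 \<in> M" using m1 m2 by (auto simp: is_L1_mean_def)
  let ?D = "d m1 m2"
  have Dpos: "?D > 0" using neq M by simp
  obtain z where z: "z \<in> supp M d P" using ne by blast
  \<comment> \<open>One support point within a right angle of both means shows that they are not
    antipodal.\<close>
  have "\<kappa> * ?D \<le> \<kappa> * (d z m1 + d z m2)"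
    using triangle[of m1 z m2] M supp_M[OF z] \<kappa>_pos by (simp add: commute)
  then have D: "\<kappa> * ?D < pi"
    using L1_mean_near_supp[OF m1 z] L1_mean_near_supp[OF m2 z] by (simp add: distrib_left)
  obtain \<gamma> where \<gamma>: "geodesic_path M d \<gamma> m1 m2" using geod M by (auto simp: geodesic_space_def)
  define m where "m = \<gamma> (1/2)"
  have m: "m \<in> M" "d m m1 = ?D / 2" "d m m2 = ?D / 2"
    using geodesic_path_dist[OF \<gamma>, of "1/2" 0] geodesic_path_dist[OF \<gamma>, of "1/2" 1] \<gamma>
    by (simp_all add: m_def geodesic_path_def image_subset_iff)
  have tri: "\<bar>d x m1 - d x m2\<bar> \<le> ?D" if "x \<in> M" for x
    using triangle[of x m1 m2] triangle[of x m2 m1] M that by (simp add: commute)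
  have le: "d x m \<le> (d x m1 + d x m2) / 2"
    and less: "\<bar>d x m1 - d x m2\<bar> < ?D \<Longrightarrow> d x m < (d x m1 + d x m2) / 2"
    if x: "x \<in> supp M d P" for x
  proof -
    have xM: "x \<in> M" using x supp_M by simp
    note arcs = arc[OF M, symmetric] arc[OF m(1) M(1), symmetric] arc[OF m(1) M(2), symmetric]
      arc[OF m(1) xM, symmetric] arc[OF xM M(1), symmetric] arc[OF xM M(2), symmetric]
    have hyp: "\<kappa> * d m m1 = \<kappa> * ?D / 2" "\<kappa> * d m m2 = \<kappa> * ?D / 2"
      "\<bar>\<kappa> * d x m1 - \<kappa> * d x m2\<bar> \<le> \<kappa> * ?D" "\<kappa> * d x m1 + \<kappa> * d x m2 < pi"
      using m L1_mean_near_supp[OF m1 x] L1_mean_near_supp[OF m2 x] tri[OF xM] \<kappa>_pos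
      by (simp_all add: abs_mult flip: right_diff_distrib)
    note * = spherical_midpoint_le[OF norm_u[OF xM] norm_u[OF M(1)] norm_u[OF M(2)] norm_u[OF m(1)],
        unfolded arcs, OF D hyp]
    have "\<kappa> * d m x \<le> \<kappa> * ((d x m1 + d x m2) / 2)" using *(1) by (simp add: distrib_left)
    then show "d x m \<le> (d x m1 + d x m2) / 2" using \<kappa>_pos by (simp add: commute)
    assume "\<bar>d x m1 - d x m2\<bar> < ?D"
    then have "\<bar>\<kappa> * d x m1 - \<kappa> * d x m2\<bar> < \<kappa> * ?D"
      using \<kappa>_pos by (simp add: abs_mult flip: right_diff_distrib)
    then have "\<kappa> * d m x < \<kappa> * ((d x m1 + d x m2) / 2)" using *(2) by (simp add: distrib_left)
    then show "d x m < (d x m1 + d x m2) / 2" using \<kappa>_pos by (simp add: commute)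
  qed
  \<comment> \<open>\<open>?h\<close> is the defect in the midpoint inequality. It is nonnegative
    almost everywhere, and minimality of the means makes its integral at most 0, so it vanishes
    almost everywhere.\<close>
  let ?h = "\<lambda>x. (d x m1 + d x m2) / 2 - d x m"
  have eq12: "(\<integral>x. d x m1 \<partial>P) = (\<integral>x. d x m2 \<partial>P)"
    using m1 m2 by (auto simp: is_L1_mean_iff intro: antisym)
  have h_nonneg: "AE x in P. 0 \<le> ?h x" using AE_supp le by (auto elim!: eventually_mono)
  have h_int: "integrable P ?h" using M m(1) dist_integrable by auto
  have "(\<integral>x. ?h x \<partial>P) = (\<integral>x. d x m1 \<partial>P) - (\<integral>x. d x m \<partial>P)"
    using M m(1) eq12 by (simp add: dist_integrable)
  also have "\<dots> \<le> 0" using m1 m(1) by (simp add: is_L1_mean_iff)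
  finally have "(\<integral>x. ?h x \<partial>P) = 0" using integral_nonneg_AE[OF h_nonneg] by simp
  then have "AE x in P. ?h x = 0" using integral_nonneg_eq_0_iff_AE[OF h_int h_nonneg] by simp
  with AE_supp have split: "AE x in P. x \<in> M \<and> \<bar>d x m1 - d x m2\<bar> = ?D"
  proof eventually_elim
    case (elim x)
    then show ?case using less[of x] tri[of x] supp_M[of x] by force
  qed
  let ?A = "{x \<in> M. d x m2 = d x m1 + d m1 m2}" and ?B = "{x \<in> M. d x m1 = d x m2 + d m2 m1}"
  have "{x \<in> space P. d x m2 = d x m1 + d m1 m2} \<in> sets P" "{x \<in> space P. d x m1 = d x m2 + d m2 m1} \<in> sets P"
    using M by measurable
  then have sets: "?A \<in> sets P" "?B \<in> sets P" by (simp_all add: space_P)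
  \<comment> \<open>The difference of the distances is \<open>?D\<close> behind \<open>m1\<close>
    and \<open>- ?D\<close> behind \<open>m2\<close>. Its integral is 0, so both sides carry the
    same mass.\<close>
  have "AE x in P. d x m2 - d x m1 = ?D * (indicator ?A x - indicator ?B x)"
    using split by eventually_elim (use Dpos in \<open>auto simp: indicator_def commute\<close>)
  then have "(\<integral>x. d x m2 - d x m1 \<partial>P) = (\<integral>x. ?D * (indicator ?A x - indicator ?B x) \<partial>P)"
    using M sets by (intro integral_cong_AE) auto
  also have "\<dots> = ?D * (measure P ?A - measure P ?B)" using sets by (simp add: less_top[symmetric])
  finally have AB: "measure P ?A = measure P ?B" using M Dpos eq12 by (simp add: dist_integrable)
  have "AE x in P. x \<in> ?A \<union> ?B"
    using split by eventually_elim (auto simp: commute)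
  then have "measure P (?A \<union> ?B) = 1" using sets by (subst prob_eq_1) auto
  moreover have "?A \<inter> ?B = {}" using Dpos by (auto simp: commute)
  ultimately have "measure P ?A + measure P ?B = 1" using sets by (simp add: finite_measure_Union)
  with AB have "measure P ?A = 1 / 2" "measure P ?B = 1 / 2" by auto
  with M neq show ?thesis unfolding evenly_split_def by blast
qed

end

end

end

section \<open>The critical diameter for L1-means on a surface of positive curvature\<close>

lemma D_L1_ge:
  assumes geod: "geodesic_space M d" and k: "k > 0" and ccs: "constant_curvature_surface M d k"
  shows "D_L1 M d \<ge> ereal (pi / (2 * sqrt k))"
proof -
  obtain f where f: "bij_betw f M (model_surface k)"
    "\<And>x y. x \<in> M \<Longrightarrow> y \<in> M \<Longrightarrow> model_dist k (f x) (f y) = d x y"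
    using ccs by (auto simp: constant_curvature_surface_def)
  have s: "sqrt k > 0" using k by simp
  interpret Metric_space M d using geod by (simp add: geodesic_space_def)
  have "bij_betw ((*\<^sub>R) (sqrt k)) (model_surface k) (sphere 0 1)"
    by (rule bij_betw_byWitness[where f' = "\<lambda>v. (1 / sqrt k) *\<^sub>R v"])
       (use k in \<open>auto simp: model_surface_def\<close>)
  then have "bij_betw (\<lambda>x. sqrt k *\<^sub>R f x) M (sphere 0 1)"
    using bij_betw_trans[OF f(1)] by (simp add: comp_def)
  moreover have "sqrt k * d x y = arccos ((sqrt k *\<^sub>R f x) \<bullet> (sqrt k *\<^sub>R f y))" if "x \<in> M" "y \<in> M" for x y
    using f(2)[OF that] s unfolding model_dist_spherical[OF k] by (simp add: field_simps)
  ultimately interpret spherical_metric M d "sqrt k" "\<lambda>x. sqrt k *\<^sub>R f x"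
    by unfold_locales (use s in auto)
  show ?thesis
    unfolding D_L1_def
  proof (rule critical_diam_geI)
    fix A assume A: "A \<subseteq> M" and diam: "diam d A < ereal (pi / (2 * sqrt k))"
    \<comment> \<open>A real number strictly between the diameter and the bound serves as the
      uniform \<open>\<delta>\<close> for every measure supported in \<open>A\<close>.\<close>
    then obtain \<delta> where \<delta>: "diam d A < ereal \<delta>" "ereal \<delta> < ereal (pi / (2 * sqrt k))"
      using ereal_dense2 by blast
    have \<delta>': "sqrt k * \<delta> < pi / 2" using \<delta>(2) s by (simp add: field_simps)
    have d\<delta>: "d x y \<le> \<delta>" if "x \<in> A" "y \<in> A" for x y
      using le_less_trans[OF dist_le_diam[OF that] \<delta>(1)] by simp
    show "A \<in> C_L1 M d"
      unfolding C_L1_def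
    proof (intro CollectI conjI allI impI A)
      fix P assume P: "borel_prob M d P" and sub: "supp M d P \<subseteq> A" and ne: "supp M d P \<noteq> {}"
      show ex: "\<exists>m. is_L1_mean M d P m" by (rule L1_mean_exists[OF P])
      assume "\<not> evenly_split M d P"
      then show "\<exists>!m. is_L1_mean M d P m"
        using ex L1_mean_unique_or_evenly_split[OF P \<delta>' _ geod ne] d\<delta> sub by blast
    qed
  qed
qed

theorem theorem5p2:
  fixes M :: "'a set" and d :: "'a \<Rightarrow> 'a \<Rightarrow> real" and k :: real
  assumes "geodesic_space M d"
  shows "(CAT M d k \<longrightarrow> D_convex M d \<ge> ereal pi / (2 * ereal (sqrt (max k 0)))) \<and>
         (CAT M d k \<longrightarrow> D_geodesic M d \<ge> ereal pi / ereal (sqrt (max k 0))) \<and>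
         (k > 0 \<and> constant_curvature_surface M d k \<longrightarrow> D_L1 M d \<ge> ereal (pi / (2 * sqrt k)))"
  using D_convex_ge D_geodesic_ge D_L1_ge[OF assms] by blast

end
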